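(* Let $q$ be a prime with $q\equiv 1\pmod 3$, and write $4q=L^2+27M^2$ with $L,M\in\mathbb{Z}$ and $L\equiv 1\pmod 3$. Let $p$ be a prime with $p\neq 2,3,q$ and $p\nmid LM$. Then \begin{align*} \sum_{k=0}^{p-1}\binom{3k}{k}\frac{M^{2k}}{q^k}&\equiv \begin{cases} 1 \pmod{p}, & \text{if } p^{\frac{q-1}{3}}\equiv 1\pmod{q};\\ \frac{\pm 3M-L}{2L} \pmod{p}, & \text{if } p^{\frac{q-1}{3}}\equiv \frac{-1\pm L/(3M)}{2}\pmod{q}, \end{cases}\\ \sum_{k=0}^{p-1}\binom{3k}{k}\frac{L^{2k}}{(27q)^k}&\equiv \begin{cases} 1 \pmod{p}, & \text{if } p^{\frac{q-1}{3}}\equiv 1\pmod{q};\\ \frac{\pm L-9M}{18M} \pmod{p}, & \text{if } p^{\frac{q-1}{3}}\equiv \frac{-1\pm 9M/L}{2}\pmod{q}, \end{cases}\\ \sum_{k=0}^{p-1}C_k^{(2)}\frac{M^{2k}}{q^k}&\equiv \begin{cases} 1 \pmod{p}, & \text{if } p^{\frac{q-1}{3}}\equiv 1\pmod{q};\\ \frac{\pm L-M}{2M} \pmod{p}, & \text{if } p^{\frac{q-1}{3}}\equiv \frac{-1\pm 9M/L}{2}\pmod{q}, \end{cases}\\ \sum_{k=0}^{p-1}C_k^{(2)}\frac{L^{2k}}{(27q)^k}&\equiv \begin{cases} 1 \pmod{p}, & \text{if } p^{\frac{q-1}{3}}\equiv 1\pmod{q};\\ \frac{\pm 27M-L}{2L}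 \pmod{p}, & \text{if } p^{\frac{q-1}{3}}\equiv \frac{-1\pm L/(3M)}{2}\pmod{q}. \end{cases} \end{align*}
   Context: $C_n^{(2)}=\frac{1}{2n+1}\binom{3n}{n}$ are the second-order Catalan numbers. Congruences between rationals with denominators prime to the modulus are in the usual sense. In each case the signs $\pm$ correspond. *)

theory Defs
  imports Complex_Main "HOL-Number_Theory.Number_Theory"
begin

definition catalan2 :: "nat \<Rightarrow> rat" where
  "catalan2 n = of_nat ((3 * n) choose n) / of_nat (2 * n + 1)"

text \<open>Congruence in the localization of the integers at the denominators prime to \<open>m\<close>.
  The rationals \<open>a\<close> and \<open>b\<close> are themselves required to lie in this ring;
  \<open>quotient_of\<close> returns the numerator and denominator in lowest terms.\<close>

definition rat_cong :: "rat \<Rightarrow> rat \<Rightarrow> int \<Rightarrow> bool"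
    (\<open>(1[_ = _] '(ratmod _'))\<close>) where
  "[a = b] (ratmod m) \<longleftrightarrow>
     coprime (snd (quotient_of a)) m \<and> coprime (snd (quotient_of b)) m \<and>
     m dvd fst (quotient_of (a - b))"

end

theory Submission
  imports Defs "Jordan_Normal_Form.Char_Poly"
begin

text \<open>
  Since \<open>(3k choose k) = (-1)^k (-1-2k choose k)\<close>, modulo \<open>p\<close> both sums are terms, with index near
  \<open>2p\<close>, of linear recurrences with characteristic polynomial \<open>t\<^sup>3 - t\<^sup>2 + x\<close>. Hence they are
  expressed through the \<open>2p\<close>-th powers of its roots, that is, through the action of Frobenius on these
  roots. The roots are \<open>(1 + z + 1/z) / 3\<close> with \<open>z\<^sup>3 = v\<close> and \<open>27 x = 2 - v - 1/v\<close>. For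
  \<open>x = M\<^sup>2/q\<close> and \<open>x = L\<^sup>2/(27q)\<close> one has \<open>v = J'/J\<close> and \<open>v = -J'/J\<close>, where \<open>J'\<close> is the conjugate of
  \<open>J = (L + 3M sqrt(-3)) / 2\<close>. Now \<open>J\<close> is the Jacobi sum of a cubic character \<open>\<chi>\<close> modulo \<open>q\<close>, and its
  Gauss sum \<open>G\<close> satisfies \<open>G\<^sup>3 = q J\<close>, so \<open>z\<close> may be taken to be \<open>G/J\<close> or \<open>-G/J\<close> up to a cube root
  of unity. The congruence for \<open>G^p\<close> modulo \<open>p\<close> shows that Frobenius permutes the roots by
  multiplying \<open>z\<close> by \<open>\<chi>(p)\<^sup>2\<close>, and \<open>\<chi>(p)\<close> is given by \<open>p^((q-1)/3)\<close> modulo \<open>q\<close>. Congruences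
  modulo \<open>p\<close> are taken in the ring of cyclotomic integers with all integers prime to \<open>p\<close> inverted.
\<close>

subsection \<open>Localized rings of cyclotomic integers\<close>

text \<open>Each sum becomes a sum over the three roots t of (t^p)^2 times a weight: 1/(3t-2) for
  the binomials, from the Binet-type formula, and 1/t for the Catalan numbers, whose power sum has
  exponent 2p-1. Frobenius is applied to t^p only; the weight stays and merely has to lie in
  \<open>R\<close>. Expanding in powers of z, only exponents divisible by 3 survive the sum over the
  roots, so the Gauss sum disappears and the value involves just J, its conjugate and \<chi>(p). The
  weights have denominators z^3 + 1 and z^3 - 1, which up to sign are L/J and 3M sqrt(-3)/J in one
  order or the other; this is where p not dividing LM enters. The delicate point is the signs. The
  sign of L is fixed by J being -1 modulo 3, which is Frobenius at the prime 3 applied to G^3 = qJ.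
  The sign of M is fixed by taking the cube root of unity \<open>w\<close> modulo q from L and M, so
  that J and (L + 3M sqrt(-3))/2 both vanish modulo q under \<omega> -> w. No prime ideal above p is
  chosen: a rational number in \<open>R\<close> has denominator prime to p, so congruences modulo p
  in \<open>R\<close> descend to the rationals.\<close>

lemma algebraic_int_integer_eigenvalue:
  fixes \<theta> :: "'a :: field_char_0" and b :: "nat \<Rightarrow> 'a" and c :: "nat \<Rightarrow> nat \<Rightarrow> int"
  assumes eq: "\<And>i. i < n \<Longrightarrow> \<theta> * b i = (\<Sum>j<n. of_int (c i j) * b j)"
    and k: "k < n" "b k \<noteq> 0"
  shows "algebraic_int \<theta>"
proof -
  \<comment> \<open>The vector \<open>b\<close> is an eigenvector of this integer matrix for the
    eigenvalue \<theta>, which is therefore a root of a monic integer polynomial.\<close>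
  define A where "A = mat n n (\<lambda>(i, j). c i j)"
  define A' where "A' = (map_mat of_int A :: 'a mat)"
  have A: "A \<in> carrier_mat n n" and A': "A' \<in> carrier_mat n n"
    by (auto simp: A_def A'_def)
  have "vec n b \<noteq> 0\<^sub>v n"
    using k by (metis index_vec index_zero_vec(1))
  moreover have "A' *\<^sub>v vec n b = \<theta> \<cdot>\<^sub>v vec n b"
    by (rule eq_vecI) (auto simp: A'_def A_def scalar_prod_def eq lessThan_atLeast0)
  ultimately have "eigenvalue A' \<theta>"
    using A' unfolding eigenvalue_def eigenvector_def by (intro exI[of _ "vec n b"]) auto
  hence "poly (char_poly A') \<theta> = 0"
    using eigenvalue_root_char_poly[OF A'] by simp
  moreover have "char_poly A' = map_poly of_int (char_poly A)"
    unfolding A'_def by (rule of_int_hom.char_poly_hom[OF A])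
  moreover have "lead_coeff (char_poly A) = 1"
    using degree_monic_char_poly[OF A] by auto
  ultimately show ?thesis
    unfolding algebraic_int_altdef_ipoly by auto
qed

text \<open>The ring of N-th cyclotomic integers, given by a spanning set that is not a basis: the
  coefficients are not unique, but integrality only needs finite generation.\<close>

definition cyclotomic_ints :: "nat \<Rightarrow> complex set" where
  "cyclotomic_ints N = range (\<lambda>c :: nat \<Rightarrow> int. \<Sum>j<N. of_int (c j) * cis (2 * pi / N) ^ j)"

lemma cyclotomic_intsI:
  "x = (\<Sum>j<N. of_int (c j) * cis (2 * pi / N) ^ j) \<Longrightarrow> x \<in> cyclotomic_ints N"
  unfolding cyclotomic_ints_def by blast

lemma cyclotomic_intsE:
  assumes "x \<in> cyclotomic_ints N"
  obtains c where "x = (\<Sum>j<N. of_int (c j) * cis (2 * pi / N) ^ j)"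
  using assms unfolding cyclotomic_ints_def by blast

lemma cis_root_power: "N > 0 \<Longrightarrow> cis (2 * pi / real N) ^ N = 1"
  by (simp add: DeMoivre)

lemma cyclotomic_ints_add:
  assumes "x \<in> cyclotomic_ints N" "y \<in> cyclotomic_ints N"
  shows "x + y \<in> cyclotomic_ints N"
proof -
  from assms obtain c d where "x = (\<Sum>j<N. of_int (c j) * cis (2 * pi / N) ^ j)"
    and "y = (\<Sum>j<N. of_int (d j) * cis (2 * pi / N) ^ j)"
    by (elim cyclotomic_intsE)
  hence "x + y = (\<Sum>j<N. of_int (c j + d j) * cis (2 * pi / N) ^ j)"
    by (simp add: sum.distrib algebra_simps)
  thus ?thesis by (rule cyclotomic_intsI)
qed

lemma cyclotomic_ints_int_mult:
  assumes "x \<in> cyclotomic_ints N"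
  shows "of_int k * x \<in> cyclotomic_ints N"
proof -
  from assms obtain c where "x = (\<Sum>j<N. of_int (c j) * cis (2 * pi / N) ^ j)"
    by (elim cyclotomic_intsE)
  hence "of_int k * x = (\<Sum>j<N. of_int (k * c j) * cis (2 * pi / N) ^ j)"
    by (simp add: sum_distrib_left algebra_simps)
  thus ?thesis by (rule cyclotomic_intsI)
qed

lemma cyclotomic_ints_0: "0 \<in> cyclotomic_ints N"
  by (rule cyclotomic_intsI[where c = "\<lambda>_. 0"]) simp

lemma cyclotomic_ints_sum:
  assumes "\<And>i. i \<in> I \<Longrightarrow> f i \<in> cyclotomic_ints N"
  shows "sum f I \<in> cyclotomic_ints N"
  using assms by (induction I rule: infinite_finite_induct) (auto intro: cyclotomic_ints_add cyclotomic_ints_0)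

lemma cyclotomic_ints_root_power:
  assumes "N > 0"
  shows "cis (2 * pi / N) ^ k \<in> cyclotomic_ints N"
proof -
  have "cis (2 * pi / N) ^ k = cis (2 * pi / N) ^ (N * (k div N) + k mod N)"
    by simp
  also have "\<dots> = cis (2 * pi / N) ^ (k mod N)"
    unfolding power_add power_mult by (simp add: cis_root_power assms)
  also have "\<dots> = (\<Sum>j<N. of_int (if j = k mod N then 1 else 0) * cis (2 * pi / N) ^ j)"
    using assms by (simp add: if_distrib if_distribR cong: if_cong)
  finally show ?thesis by (rule cyclotomic_intsI)
qed

lemma cyclotomic_ints_mult:
  assumes "N > 0" "x \<in> cyclotomic_ints N" "y \<in> cyclotomic_ints N"
  shows "x * y \<in> cyclotomic_ints N"
proof -
  from assms obtain c d where "x = (\<Sum>j<N. of_int (c j) * cis (2 * pi / N) ^ j)"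
    and "y = (\<Sum>j<N. of_int (d j) * cis (2 * pi / N) ^ j)"
    by (elim cyclotomic_intsE)
  hence "x * y = (\<Sum>i<N. \<Sum>j<N. of_int (c i * d j) * cis (2 * pi / N) ^ (i + j))"
    by (simp only: sum_product power_add of_int_mult mult_ac)
  also have "\<dots> \<in> cyclotomic_ints N"
    by (intro cyclotomic_ints_sum cyclotomic_ints_int_mult cyclotomic_ints_root_power assms)
  finally show ?thesis .
qed

text \<open>Multiplication by \<open>x\<close> maps the finitely generated module of cyclotomic
  integers to itself; its generator with index 0 is 1, hence nonzero.\<close>

lemma algebraic_int_cyclotomic:
  assumes "N > 0" "x \<in> cyclotomic_ints N"
  shows "algebraic_int x"
proof -
  have "\<exists>c :: nat \<Rightarrow> int. x * cis (2 * pi / N) ^ i = (\<Sum>j<N. of_int (c j) * cis (2 * pi / N) ^ j)" for i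
    using cyclotomic_ints_mult[OF assms cyclotomic_ints_root_power[OF assms(1), of i]]
    by (elim cyclotomic_intsE) blast
  then obtain c :: "nat \<Rightarrow> nat \<Rightarrow> int" where
    "\<And>i. x * cis (2 * pi / N) ^ i = (\<Sum>j<N. of_int (c i j) * cis (2 * pi / N) ^ j)"
    by metis
  thus ?thesis
    using assms(1) by (intro algebraic_int_integer_eigenvalue[of N x "\<lambda>i. cis (2 * pi / N) ^ i" c 0]) auto
qed

lemma rational_cyclotomic_int_is_int:
  assumes "N > 0" "of_rat r \<in> cyclotomic_ints N"
  shows "r \<in> \<int>"
proof -
  have "(of_rat r :: complex) \<in> \<int>"
    using assms by (intro rational_algebraic_int_is_int algebraic_int_cyclotomic) auto
  then obtain k where "(of_rat r :: complex) = of_int k" by (auto elim: Ints_cases)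
  hence "(of_rat r :: complex) = of_rat (of_int k)" by simp
  thus ?thesis unfolding of_rat_eq_iff by simp
qed

section \<open>The localized ring and congruence modulo p in it\<close>

locale cyclotomic_localization =
  fixes p N :: nat
  assumes p: "prime p" and N: "N > 0"
begin

definition R :: "complex set" where
  "R = {z. \<exists>n. \<not> int p dvd n \<and> of_int n * z \<in> cyclotomic_ints N}"

text \<open>Only the difference is constrained; \<open>a\<close> and \<open>b\<close> may lie
  outside \<open>R\<close>. Hence the membership hypotheses in the multiplicative rules.\<close>

definition cg :: "complex \<Rightarrow> complex \<Rightarrow> bool" (infix \<open>\<approx>\<close> 50) where
  "a \<approx> b \<longleftrightarrow> (a - b) / of_nat p \<in> R"

lemma prime_int_p: "prime (int p)" using p by simp

lemma not_dvd_mult: "\<not> int p dvd m \<Longrightarrow> \<not> int p dvd n \<Longrightarrow> \<not> int p dvd m * n"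
  using prime_int_p prime_dvd_mult_iff by blast

lemma R_cyclotomic: "x \<in> cyclotomic_ints N \<Longrightarrow> x \<in> R"
  unfolding R_def using p by (auto intro!: exI[of _ 1] simp: prime_nat_iff)

lemma R_root_power [intro]: "cis (2 * pi / N) ^ k \<in> R"
  by (intro R_cyclotomic cyclotomic_ints_root_power N)

lemma R_of_int [intro, simp]: "of_int k \<in> R"
  using cyclotomic_ints_int_mult[OF cyclotomic_ints_root_power[OF N, of 0], of k]
  by (intro R_cyclotomic) simp

lemma R_1 [intro, simp]: "1 \<in> R" using R_of_int[of 1] by simp
lemma R_0 [intro, simp]: "0 \<in> R" using R_of_int[of 0] by simp
lemma R_of_nat [intro, simp]: "of_nat k \<in> R" using R_of_int[of "int k"] by simp
lemma R_numeral [intro, simp]: "numeral k \<in> R" using R_of_nat[of "numeral k"] by simp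

lemma R_mult [intro]: "x \<in> R \<Longrightarrow> y \<in> R \<Longrightarrow> x * y \<in> R"
proof -
  assume "x \<in> R" "y \<in> R"
  then obtain m n where "\<not> int p dvd m" "\<not> int p dvd n"
    "of_int m * x \<in> cyclotomic_ints N" "of_int n * y \<in> cyclotomic_ints N"
    unfolding R_def by blast
  thus "x * y \<in> R"
    using not_dvd_mult[of m n] cyclotomic_ints_mult[OF N, of "of_int m * x" "of_int n * y"]
    unfolding R_def by (auto intro!: exI[of _ "m * n"] simp: algebra_simps)
qed

lemma R_add [intro]: "x \<in> R \<Longrightarrow> y \<in> R \<Longrightarrow> x + y \<in> R"
proof -
  assume "x \<in> R" "y \<in> R"
  then obtain m n where "\<not> int p dvd m" "\<not> int p dvd n"
    "of_int m * x \<in> cyclotomic_ints N" "of_int n * y \<in> cyclotomic_ints N"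
    unfolding R_def by blast
  thus "x + y \<in> R"
    using not_dvd_mult[of m n] cyclotomic_ints_add[OF
        cyclotomic_ints_int_mult[of "of_int m * x" N n] cyclotomic_ints_int_mult[of "of_int n * y" N m]]
    unfolding R_def by (auto intro!: exI[of _ "m * n"] simp: algebra_simps)
qed

lemma R_uminus [intro]: "x \<in> R \<Longrightarrow> - x \<in> R"
  using R_mult[OF R_of_int[of "-1"], of x] by simp

lemma R_diff [intro]: "x \<in> R \<Longrightarrow> y \<in> R \<Longrightarrow> x - y \<in> R"
  using R_add[of x "- y"] R_uminus by simp

lemma R_power [intro]: "x \<in> R \<Longrightarrow> x ^ k \<in> R"
  by (induction k) auto

lemma R_sum [intro]: "(\<And>i. i \<in> I \<Longrightarrow> f i \<in> R) \<Longrightarrow> sum f I \<in> R"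
  by (induction I rule: infinite_finite_induct) auto

lemma R_inverse_int:
  assumes "\<not> int p dvd n"
  shows "inverse (of_int n) \<in> R"
proof -
  have "of_int n * inverse (of_int n) = (1 :: complex)"
    using assms by (intro right_inverse) auto
  thus ?thesis using assms cyclotomic_ints_root_power[OF N, of 0] unfolding R_def by auto
qed

lemma R_divide_int: "x \<in> R \<Longrightarrow> \<not> int p dvd n \<Longrightarrow> x / of_int n \<in> R"
  unfolding divide_inverse by (intro R_mult R_inverse_int)

text \<open>Some \<open>n\<close> prime to p makes \<open>n * r\<close> a rational algebraic
  integer, hence an integer; so the reduced denominator of \<open>r\<close> divides
  \<open>n\<close>.\<close>

lemma R_rat_denom:
  assumes "of_rat r \<in> R"
  shows "coprime (snd (quotient_of r)) (int p)"
proof -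
  obtain a b where ab: "quotient_of r = (a, b)" by force
  have b: "b > 0" "coprime a b" "r = of_int a / of_int b"
    using quotient_of_denom_pos[OF ab] quotient_of_coprime[OF ab] quotient_of_div[OF ab] by auto
  from assms obtain n where n: "\<not> int p dvd n" "of_int n * of_rat r \<in> cyclotomic_ints N"
    unfolding R_def by blast
  have "of_rat (of_int n * r) \<in> cyclotomic_ints N" using n(2) by (simp add: of_rat_mult)
  then obtain k where "of_int n * r = of_int k"
    using rational_cyclotomic_int_is_int[OF N] by (auto elim: Ints_cases)
  hence "of_int (n * a) = (of_int (k * b) :: rat)" using b by (simp add: field_simps)
  hence "n * a = k * b" unfolding of_int_eq_iff .
  hence "b dvd n" using b(2) by (metis coprime_commute coprime_dvd_mult_left_iff dvd_triv_right)
  hence "\<not> int p dvd b" using n(1) dvd_trans by blast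
  thus ?thesis
    using prime_int_p ab by (metis coprime_commute prime_imp_coprime snd_conv)
qed

text \<open>The way back from \<open>R\<close> to the rationals: the quotient (a - b)/p is itself
  rational and in \<open>R\<close>, so its denominator is prime to p and the factor p stays in the
  numerator of a - b.\<close>

lemma rat_congI:
  assumes "of_rat a \<in> R" "of_rat b \<in> R" "of_rat a \<approx> of_rat b"
  shows "[a = b] (ratmod int p)"
proof -
  define x where "x = (a - b) / of_nat p"
  have "of_rat x \<in> R" using assms(3) unfolding cg_def x_def by (simp add: of_rat_divide of_rat_diff)
  obtain n d where nd: "quotient_of x = (n, d)" by force
  obtain n' d' where nd': "quotient_of (a - b) = (n', d')" by force
  have d: "coprime d (int p)" "d > 0" "x = of_int n / of_int d"
    using R_rat_denom[OF \<open>of_rat x \<in> R\<close>] quotient_of_denom_pos[OF nd] quotient_of_div[OF nd] nd by auto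
  have d': "d' > 0" "a - b = of_int n' / of_int d'"
    using quotient_of_denom_pos[OF nd'] quotient_of_div[OF nd'] by auto
  have "p > 0" using p prime_gt_0_nat by blast
  hence "of_int n' / of_int d' = of_nat p * (of_int n / of_int d :: rat)"
    unfolding d'(2)[symmetric] d(3)[symmetric] x_def by simp
  hence "of_int (n' * d) = (of_int (int p * (n * d')) :: rat)"
    using d(2) d'(1) by (simp add: field_simps)
  hence "n' * d = int p * (n * d')" unfolding of_int_eq_iff .
  hence "int p dvd n'" using d(1) by (metis coprime_commute coprime_dvd_mult_left_iff dvd_triv_left)
  thus ?thesis
    unfolding rat_cong_def using R_rat_denom assms(1,2) nd' by simp
qed

lemma cg_int_iff: "of_int a \<approx> of_int b \<longleftrightarrow> int p dvd a - b"
proof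
  assume "of_int a \<approx> of_int b"
  hence "[of_int a = of_int b] (ratmod int p)" by (intro rat_congI) auto
  hence "int p dvd fst (quotient_of (of_int (a - b)))" unfolding rat_cong_def by simp
  thus "int p dvd a - b" unfolding quotient_of_rat_of_int by simp
next
  assume "int p dvd a - b"
  then obtain k where "a - b = int p * k" by blast
  hence "(of_int a - of_int b :: complex) = of_int (int p * k)" by (metis of_int_diff)
  thus "of_int a \<approx> of_int b" using p unfolding cg_def by (auto simp: prime_gt_0_nat)
qed

lemma cg_refl [intro, simp]: "a \<approx> a" unfolding cg_def by simp

lemma cg_sym: "a \<approx> b \<Longrightarrow> b \<approx> a"
  unfolding cg_def using R_uminus by (metis minus_diff_eq minus_divide_left)

lemma cg_add: "a \<approx> b \<Longrightarrow> c \<approx> d \<Longrightarrow> a + c \<approx> b + d"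
  unfolding cg_def using R_add[of "(a - b) / of_nat p" "(c - d) / of_nat p"]
  by (simp add: diff_divide_distrib add_divide_distrib algebra_simps)

lemma cg_trans [trans]: "a \<approx> b \<Longrightarrow> b \<approx> c \<Longrightarrow> a \<approx> c"
  using cg_add[of a b b c] unfolding cg_def by simp

lemma cg_mult_left: "a \<approx> b \<Longrightarrow> c \<in> R \<Longrightarrow> c * a \<approx> c * b"
  unfolding cg_def using R_mult[of c "(a - b) / of_nat p"] by (simp add: algebra_simps)

lemma cg_mult_right: "a \<approx> b \<Longrightarrow> c \<in> R \<Longrightarrow> a * c \<approx> b * c"
  using cg_mult_left by (simp add: mult.commute)

lemma cg_R: "a \<approx> b \<Longrightarrow> b \<in> R \<Longrightarrow> a \<in> R"
proof -
  assume "a \<approx> b" "b \<in> R"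
  moreover have "a = of_nat p * ((a - b) / of_nat p) + b" using p by (auto simp: prime_gt_0_nat)
  ultimately show "a \<in> R" unfolding cg_def by (metis R_add R_mult R_of_nat)
qed

lemma cg_mult:
  assumes "a \<approx> b" "c \<approx> d" "b \<in> R" "c \<in> R"
  shows "a * c \<approx> b * d"
  using cg_trans[OF cg_mult_right[OF assms(1,4)] cg_mult_left[OF assms(2,3)]] .

lemma cg_power: "a \<approx> b \<Longrightarrow> b \<in> R \<Longrightarrow> a ^ k \<approx> b ^ k"
proof (induction k)
  case (Suc k)
  thus ?case using cg_mult[of a b "a ^ k" "b ^ k"] cg_R by auto
qed simp

lemma cg_uminus: "a \<approx> b \<Longrightarrow> - a \<approx> - b"
  using cg_mult_left[of a b "- 1"] by auto

lemma cg_diff: "a \<approx> b \<Longrightarrow> c \<approx> d \<Longrightarrow> a - c \<approx> b - d"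
  using cg_add[of a b "- c" "- d"] cg_uminus by simp

lemma cg_sum: "(\<And>i. i \<in> I \<Longrightarrow> f i \<approx> g i) \<Longrightarrow> sum f I \<approx> sum g I"
  by (induction I rule: infinite_finite_induct) (auto intro: cg_add)

section \<open>Frobenius modulo p\<close>

lemma frobenius_add:
  assumes "x \<in> R" "y \<in> R"
  shows "(x + y) ^ p \<approx> x ^ p + y ^ p"
proof -
  have p0: "p > 0" using p by (simp add: prime_gt_0_nat)
  have "(x + y) ^ p = (\<Sum>k\<le>p. of_nat (p choose k) * x ^ k * y ^ (p - k))"
    by (rule binomial_ring)
  also have "{..p} = insert 0 (insert p {1..<p})" using p0 by auto
  also have "(\<Sum>k\<in>\<dots>. of_nat (p choose k) * x ^ k * y ^ (p - k)) =
      x ^ p + y ^ p + (\<Sum>k=1..<p. of_nat (p choose k) * x ^ k * y ^ (p - k))"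
    using p0 by simp
  finally have "((x + y) ^ p - (x ^ p + y ^ p)) / of_nat p =
      (\<Sum>k=1..<p. of_nat (p choose k) * x ^ k * y ^ (p - k)) / of_nat p"
    by simp
  also have "\<dots> = (\<Sum>k=1..<p. of_nat ((p choose k) div p) * x ^ k * y ^ (p - k))"
    unfolding sum_divide_distrib
  proof (rule sum.cong)
    fix k assume "k \<in> {1..<p}"
    hence "p dvd (p choose k)" using p by (intro dvd_choose_prime) auto
    hence "(of_nat (p choose k) :: complex) = of_nat p * of_nat ((p choose k) div p)"
      by (metis dvd_mult_div_cancel of_nat_mult)
    thus "of_nat (p choose k) * x ^ k * y ^ (p - k) / of_nat p =
        of_nat ((p choose k) div p) * x ^ k * y ^ (p - k)"
      using p0 by simp
  qed simp
  also have "\<dots> \<in> R" using assms by (intro R_sum R_mult R_power R_of_nat)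
  finally show ?thesis unfolding cg_def .
qed

lemma frobenius_sum:
  assumes "\<And>i. i \<in> I \<Longrightarrow> f i \<in> R"
  shows "sum f I ^ p \<approx> (\<Sum>i\<in>I. f i ^ p)"
  using assms
proof (induction I rule: infinite_finite_induct)
  case (insert i I)
  have "(f i + sum f I) ^ p \<approx> f i ^ p + sum f I ^ p"
    using insert by (intro frobenius_add) auto
  also have "\<dots> \<approx> f i ^ p + (\<Sum>i\<in>I. f i ^ p)"
    using insert by (intro cg_add) auto
  finally show ?case using insert by simp
qed (auto simp: zero_power[OF prime_gt_0_nat[OF p]])

lemma frobenius_nat: "of_nat n ^ p \<approx> of_nat n"
  using frobenius_sum[of "{..<n}" "\<lambda>_. 1"] by simp

lemma frobenius_int: "of_int n ^ p \<approx> of_int n"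
proof (cases "n \<ge> 0")
  case True
  thus ?thesis using frobenius_nat[of "nat n"] by simp
next
  case False
  \<comment> \<open>Additivity applied to n + (-n) = 0 treats negative \<open>n\<close> without
    splitting on the parity of p.\<close>
  have "(of_int n + of_nat (nat (- n))) ^ p \<approx> of_int n ^ p + of_nat (nat (- n)) ^ p"
    by (intro frobenius_add) auto
  moreover have "(of_int n + of_nat (nat (- n))) ^ p = (0 :: complex)"
    using False p by (auto simp: prime_gt_0_nat)
  ultimately have "of_int n ^ p + of_nat (nat (- n)) ^ p \<approx> 0" by (simp add: cg_sym)
  from cg_diff[OF this frobenius_nat[of "nat (- n)"]]
  have "of_int n ^ p \<approx> - of_nat (nat (- n))" by simp
  thus ?thesis using False by simp
qed

lemma frobenius_inverse_int:
  assumes "\<not> int p dvd n"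
  shows "inverse (of_int n) ^ p \<approx> inverse (of_int n)"
proof -
  have n0: "of_int n \<noteq> (0 :: complex)" using assms by auto
  have i: "inverse (of_int n) \<in> R" using assms by (rule R_inverse_int)
  have "inverse (of_int n) ^ p * of_int n ^ p * inverse (of_int n)
      \<approx> inverse (of_int n) ^ p * of_int n * inverse (of_int n)"
    using i by (intro cg_mult_right cg_mult_left frobenius_int) auto
  thus ?thesis using n0 cg_sym by (simp add: field_simps)
qed

end

subsection \<open>Binomial sums modulo a prime\<close>

text \<open>The coefficient of \<open>z^n\<close> in \<open>1 / (1 - z + x z\<^sup>3)\<close>. Truncated subtraction is harmless here,
  because \<open>0 choose k\<close> vanishes for \<open>k > 0\<close>.\<close>

definition trinomial_sum :: "'a :: comm_ring_1 \<Rightarrow> nat \<Rightarrow> 'a" where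
  "trinomial_sum x n = (\<Sum>k\<le>n. of_nat ((n - 2 * k) choose k) * (- x) ^ k)"

text \<open>For k > m one has 2k > n, so the truncated \<open>n - 2 * k\<close> is 0 and the
  binomial vanishes. This makes the upper limit adjustable.\<close>

lemma trinomial_sum_upper:
  assumes "n \<le> 2 * m + 1"
  shows "trinomial_sum x n = (\<Sum>k\<le>m. of_nat ((n - 2 * k) choose k) * (- x) ^ k)"
proof -
  have z: "of_nat ((n - 2 * k) choose k) * (- x) ^ k = 0" if "n < k \<or> m < k" for k
  proof -
    have "n - 2 * k < k" using assms that by auto
    thus ?thesis by (simp add: binomial_eq_0)
  qed
  have "trinomial_sum x n = (\<Sum>k\<le>min n m. of_nat ((n - 2 * k) choose k) * (- x) ^ k)"
    unfolding trinomial_sum_def by (rule sum.mono_neutral_right, simp, simp, rule ballI, rule z) auto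
  also have "\<dots> = (\<Sum>k\<le>m. of_nat ((n - 2 * k) choose k) * (- x) ^ k)"
    by (rule sum.mono_neutral_left, simp, simp, rule ballI, rule z) auto
  finally show ?thesis .
qed

text \<open>Pascal's rule termwise: the upper entry n + 3 - 2(j+1) is the successor of n - 2j. The
  limits are first aligned so that the shift k = j + 1 matches.\<close>

lemma trinomial_sum_rec:
  "trinomial_sum x (n + 3) = trinomial_sum x (n + 2) - x * trinomial_sum x n"
proof -
  define b where "b m k = (of_nat ((m - 2 * k) choose k) :: 'a)" for m k
  have pascal: "b (n + 3) (Suc j) = b (n + 2) (Suc j) + b n j" for j
  proof (cases "2 * j \<le> n")
    case True
    hence "n + 3 - 2 * Suc j = Suc (n - 2 * j)" "n + 2 - 2 * Suc j = n - 2 * j" by auto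
    thus ?thesis by (simp add: b_def)
  next
    case False
    thus ?thesis by (cases j) (auto simp: b_def)
  qed
  have "trinomial_sum x (n + 3) = (\<Sum>k\<le>Suc (n + 1). b (n + 3) k * (- x) ^ k)"
    unfolding b_def by (rule trinomial_sum_upper) simp
  also have "\<dots> = 1 + (\<Sum>j\<le>n + 1. b (n + 3) (Suc j) * (- x) ^ Suc j)"
    unfolding sum.atMost_Suc_shift by (simp add: b_def)
  also have "\<dots> = 1 + (\<Sum>j\<le>n + 1. b (n + 2) (Suc j) * (- x) ^ Suc j)
      - x * (\<Sum>j\<le>n + 1. b n j * (- x) ^ j)"
    unfolding pascal distrib_right sum.distrib sum_distrib_left
    by (simp only: power_Suc mult_ac mult_minus_left mult_minus_right sum_negf) simp
  also have "1 + (\<Sum>j\<le>n + 1. b (n + 2) (Suc j) * (- x) ^ Suc j) =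
      (\<Sum>k\<le>Suc (n + 1). b (n + 2) k * (- x) ^ k)"
    unfolding sum.atMost_Suc_shift by (simp add: b_def)
  also have "\<dots> = trinomial_sum x (n + 2)"
    unfolding b_def by (rule trinomial_sum_upper[symmetric]) simp
  also have "(\<Sum>j\<le>n + 1. b n j * (- x) ^ j) = trinomial_sum x n"
    unfolding b_def by (rule trinomial_sum_upper[symmetric]) simp
  finally show ?thesis .
qed

section \<open>Reflection of binomial coefficients and the second-order Catalan numbers\<close>

lemma fact_times_binomial_int:
  "fact k * int (n choose k) = (\<Prod>i<k. int n - int i)"
proof -
  have "(of_int (fact k * int (n choose k)) :: rat) = fact k * (of_nat n gchoose k)"
    by (simp add: binomial_gbinomial)
  also have "\<dots> = (\<Prod>i = 0..<k. of_nat n - of_nat i)"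
    by (rule gbinomial_mult_fact)
  also have "\<dots> = of_int (\<Prod>i<k. int n - int i)"
    by (simp add: lessThan_atLeast0)
  finally show ?thesis unfolding of_int_eq_iff .
qed

text \<open>The polynomial identity (n choose k) = (-1)^k (k-1-n choose k) with k-1-n replaced by
  any natural number \<open>m\<close> in its residue class. This is allowed because k! is invertible
  modulo p for k < p.\<close>

lemma binomial_reflection_cong:
  assumes p: "prime p" and k: "k < p"
    and s: "[int n + int m = int k - 1] (mod int p)"
  shows "[int (n choose k) = (- 1) ^ k * int (m choose k)] (mod int p)"
proof -
  have "(\<Prod>i<k. int m - int i) = (\<Prod>i<k. int m - int (k - Suc i))"
    by (rule prod.nat_diff_reindex[symmetric])
  moreover have "(\<Prod>i<k. - (int m - int (k - Suc i))) = (- 1) ^ k * (\<Prod>i<k. int m - int (k - Suc i))"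
    using prod_uminus[of "\<lambda>i. int m - int (k - Suc i)" "{..<k}"] by (simp only: card_lessThan)
  ultimately have "[(- 1) ^ k * (\<Prod>i<k. int m - int i) = (\<Prod>i<k. - (int m - int (k - Suc i)))] (mod int p)"
    by (metis cong_refl)
  also have "[(\<Prod>i<k. - (int m - int (k - Suc i))) = (\<Prod>i<k. int n - int i)] (mod int p)"
  proof (rule cong_prod)
    fix i assume "i \<in> {..<k}"
    hence eq: "int n - int i - - (int m - int (k - Suc i)) = int n + int m - (int k - 1)"
      by (auto simp: of_nat_diff)
    have "[int n - int i = - (int m - int (k - Suc i))] (mod int p)"
      unfolding cong_iff_dvd_diff eq using s by (simp add: cong_iff_dvd_diff)
    thus "[- (int m - int (k - Suc i)) = int n - int i] (mod int p)" by (rule cong_sym)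
  qed
  finally have "[fact k * ((- 1) ^ k * int (m choose k)) = fact k * int (n choose k)] (mod int p)"
    unfolding fact_times_binomial_int[symmetric] by (simp add: mult_ac)
  moreover have "coprime (fact k) (int p)"
  proof -
    have "\<not> p dvd fact k" using p k by (simp add: prime_dvd_fact_iff)
    hence "coprime p (fact k)" using p by (simp add: prime_imp_coprime)
    hence "coprime (int (fact k)) (int p)" unfolding coprime_int_iff by (simp add: coprime_commute)
    thus ?thesis by (simp only: of_nat_fact)
  qed
  ultimately show ?thesis by (metis cong_mult_lcancel cong_sym)
qed

lemma catalan2_0: "catalan2 0 = 1"
  by (simp add: catalan2_def)

text \<open>Removes the denominator 2k+1, which for odd p equals p at k = (p-1)/2, inside the range
  of summation.\<close>

lemma catalan2_Suc:
  "catalan2 (Suc j) = of_nat ((3 * Suc j) choose Suc j) - 2 * of_nat ((3 * Suc j) choose j)"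
proof -
  have "(2 * j + 3) * ((3 * Suc j) choose j) = Suc j * ((3 * Suc j) choose Suc j)"
    using binomial_absorb_comp[of "3 * Suc j" j] binomial_absorption[of j "3 * Suc j"]
    by (simp add: algebra_simps)
  hence "of_nat ((2 * j + 3) * ((3 * Suc j) choose j)) =
      (of_nat (Suc j * ((3 * Suc j) choose Suc j)) :: rat)" by simp
  thus ?thesis unfolding catalan2_def of_nat_mult by (simp add: field_simps)
qed

context cyclotomic_localization
begin

lemma cg_int_cong: "[a = b] (mod int p) \<Longrightarrow> of_int a \<approx> of_int b"
  by (simp add: cg_int_iff cong_iff_dvd_diff)

text \<open>Reflecting 3k gives -1-2k modulo p. Adding 2p makes this the natural number 2p-1-2k for
  all k < p, with no truncation; hence the index 2p-1.\<close>

lemma binomial_sum_cg: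
  assumes "x \<in> R"
  shows "(\<Sum>k = 0..p - 1. of_nat ((3 * k) choose k) * x ^ k) \<approx> trinomial_sum x (2 * p - 1)"
proof -
  have p2: "p \<ge> 2" using p by (rule prime_ge_2_nat)
  have "(\<Sum>k = 0..p - 1. of_nat ((3 * k) choose k) * x ^ k) \<approx>
      (\<Sum>k = 0..p - 1. of_int ((- 1) ^ k * int ((2 * p - 1 - 2 * k) choose k)) * x ^ k)"
  proof (intro cg_sum cg_mult_right R_power assms)
    fix k assume "k \<in> {0..p - 1}"
    hence k: "k < p" using p2 by auto
    have "int (3 * k) + int (2 * p - 1 - 2 * k) - (int k - 1) = int p * 2"
      using k by (simp add: of_nat_diff)
    hence "[int (3 * k) + int (2 * p - 1 - 2 * k) = int k - 1] (mod int p)"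
      by (simp add: cong_iff_dvd_diff)
    from cg_int_cong[OF binomial_reflection_cong[OF p k this]]
    show "of_nat ((3 * k) choose k) \<approx> of_int ((- 1) ^ k * int ((2 * p - 1 - 2 * k) choose k))"
      by simp
  qed
  also have "(\<Sum>k = 0..p - 1. of_int ((- 1) ^ k * int ((2 * p - 1 - 2 * k) choose k)) * x ^ k) =
      (\<Sum>k\<le>p - 1. of_nat ((2 * p - 1 - 2 * k) choose k) * (- x) ^ k)"
    by (rule sum.cong) (auto simp: power_minus[of x] mult_ac)
  also have "\<dots> = trinomial_sum x (2 * p - 1)"
    by (rule trinomial_sum_upper[symmetric]) (use p2 in simp)
  finally show ?thesis .
qed

text \<open>The term k = j + 1 differs from its binomial by -2 (3j+3 choose j) x^(j+1), and the term
  0 does not differ. Reflecting 3j+3 with lower entry j gives -4-2j, so 2p-4-2j, which is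
  nonnegative up to j = p-2.\<close>

lemma catalan2_sum_cg:
  assumes "x \<in> R"
  shows "(\<Sum>k = 0..p - 1. of_rat (catalan2 k) * x ^ k) \<approx>
    trinomial_sum x (2 * p - 1) - 2 * x * trinomial_sum x (2 * p - 4)"
proof -
  have p2: "p \<ge> 2" using p by (rule prime_ge_2_nat)
  define m where "m = p - 2"
  have pm: "p - 1 = Suc m" "p = m + 2" using p2 by (auto simp: m_def)
  define f where "f k = (of_rat (catalan2 k) - of_nat ((3 * k) choose k) :: complex) * x ^ k" for k
  have f: "f (Suc j) = - 2 * x * (of_nat ((3 * Suc j) choose j) * x ^ j)" for j
    unfolding f_def catalan2_Suc by (simp add: of_rat_diff of_rat_mult)
  have "(\<Sum>k = 0..p - 1. of_rat (catalan2 k) * x ^ k) =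
      (\<Sum>k = 0..p - 1. of_nat ((3 * k) choose k) * x ^ k) + (\<Sum>k = 0..p - 1. f k)"
    unfolding sum.distrib[symmetric] f_def by (simp add: algebra_simps)
  also have "(\<Sum>k = 0..p - 1. f k) = f 0 + (\<Sum>j\<le>m. f (Suc j))"
    unfolding pm(1) atLeast0AtMost sum.atMost_Suc_shift ..
  also have "\<dots> = - 2 * x * (\<Sum>j\<le>m. of_nat ((3 * Suc j) choose j) * x ^ j)"
    unfolding f sum_distrib_left by (simp add: f_def catalan2_0)
  also have "(\<Sum>k = 0..p - 1. of_nat ((3 * k) choose k) * x ^ k) +
      - 2 * x * (\<Sum>j\<le>m. of_nat ((3 * Suc j) choose j) * x ^ j) \<approx>
      trinomial_sum x (2 * p - 1) +
      - 2 * x * (\<Sum>j\<le>m. of_int ((- 1) ^ j * int ((2 * p - 4 - 2 * j) choose j)) * x ^ j)"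
  proof (intro cg_add cg_mult_left binomial_sum_cg cg_sum cg_mult_right R_power R_mult R_uminus assms)
    fix j assume "j \<in> {..m}"
    hence j: "j < p" "j \<le> p - 2" using p2 by (auto simp: m_def)
    have "int (3 * Suc j) + int (2 * p - 4 - 2 * j) - (int j - 1) = int p * 2"
      using j p2 by (simp add: of_nat_diff)
    hence "[int (3 * Suc j) + int (2 * p - 4 - 2 * j) = int j - 1] (mod int p)"
      by (simp add: cong_iff_dvd_diff)
    from cg_int_cong[OF binomial_reflection_cong[OF p j(1) this]]
    show "of_nat ((3 * Suc j) choose j) \<approx> of_int ((- 1) ^ j * int ((2 * p - 4 - 2 * j) choose j))"
      by simp
  qed auto
  also have "(\<Sum>j\<le>m. of_int ((- 1) ^ j * int ((2 * p - 4 - 2 * j) choose j)) * x ^ j) =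
      (\<Sum>k\<le>m. of_nat ((2 * p - 4 - 2 * k) choose k) * (- x) ^ k)"
    by (rule sum.cong) (auto simp: power_minus[of x] mult_ac)
  also have "\<dots> = trinomial_sum x (2 * p - 4)"
    by (rule trinomial_sum_upper[symmetric]) (use pm in simp)
  finally show ?thesis by simp
qed

end

subsection \<open>The roots of the characteristic cubic\<close>

definition cubic_root_param :: "'a :: field \<Rightarrow> 'a" where
  "cubic_root_param z = (1 + z + 1 / z) / 3"

text \<open>For a primitive cube root of unity \<omega>, the arguments are the solutions z of z^3 =
  u^3, which parametrize the roots of the characteristic cubic.\<close>

definition cube_orbit_sum :: "complex \<Rightarrow> (complex \<Rightarrow> complex) \<Rightarrow> complex \<Rightarrow> complex" where
  "cube_orbit_sum \<omega> f u = f u + f (\<omega> * u) + f (\<omega>\<^sup>2 * u)"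

lemma quadratic_divide:
  fixes a b c e y z :: "'a :: field"
  shows "(a + b * z + c * y) / e = a / e + b / e * z + c / e * y"
  by (simp add: add_divide_distrib)

text \<open>With t the parametrized value and s = z + 1/z = 3t - 1, the identity z^3 + 1/z^3 = s^3 -
  3s reads 27t^3 - 27t^2 + 2.\<close>

lemma cubic_root_param_cubic:
  fixes z :: "'a :: field_char_0"
  assumes "z \<noteq> 0"
  shows "cubic_root_param z ^ 3 = cubic_root_param z ^ 2 - (2 - z ^ 3 - 1 / z ^ 3) / 27"
  using assms unfolding cubic_root_param_def by (simp add: field_simps power2_eq_square power3_eq_cube)

context
  fixes \<omega> :: complex
  assumes \<omega>: "\<omega>\<^sup>2 + \<omega> + 1 = 0"
begin

lemma omega_cube: "\<omega> ^ 3 = 1"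
  using \<omega> by Groebner_Basis.algebra

lemma cube_orbit:
  "(\<omega> * u) ^ 3 = u ^ 3" "(\<omega>\<^sup>2 * u) ^ 3 = u ^ 3"
proof -
  show 1: "(\<omega> * u) ^ 3 = u ^ 3" for u by (simp add: power_mult_distrib omega_cube)
  show "(\<omega>\<^sup>2 * u) ^ 3 = u ^ 3" using 1[of "\<omega> * u"] 1[of u] by (simp add: power2_eq_square mult_ac)
qed

text \<open>Summing over the orbit of multiplication by \<open>\<omega>\<close> extracts the exponents divisible by 3.\<close>

lemma cube_orbit_sum_eq:
  assumes "\<And>z. z ^ 3 = u ^ 3 \<Longrightarrow> f z = a + b * z + c * z\<^sup>2"
  shows "cube_orbit_sum \<omega> f u = 3 * a"
  unfolding cube_orbit_sum_def assms[OF refl] assms[OF cube_orbit(1)] assms[OF cube_orbit(2)]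
  using \<omega> by Groebner_Basis.algebra

lemma cube_orbit_sum_cong:
  assumes "\<And>z. z ^ 3 = u ^ 3 \<Longrightarrow> f z = g z"
  shows "cube_orbit_sum \<omega> f u = cube_orbit_sum \<omega> g u"
  unfolding cube_orbit_sum_def using assms cube_orbit by simp

text \<open>The Binet-type formula: for f(t) = t^3 - t^2 + x the terms are the sums of t^(n+2)/f'(t)
  over the roots, and f'(t) = t(3t-2). The factor \<open>z * (z + 1) / (z ^ 3 + 1)\<close> is
  1/(3t-2), since 3t - 2 = z - 1 + 1/z.\<close>

lemma trinomial_sum_closed_form:
  assumes u: "u \<noteq> 0" "u ^ 3 \<noteq> - 1"
  defines "x \<equiv> (2 - u ^ 3 - 1 / u ^ 3) / 27"
  shows "trinomial_sum x n =
    cube_orbit_sum \<omega> (\<lambda>z. cubic_root_param z ^ (n + 1) * (z * (z + 1) / (z ^ 3 + 1))) u"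
proof -
  let ?W = "\<lambda>n. cube_orbit_sum \<omega> (\<lambda>z. cubic_root_param z ^ n * (z * (z + 1) / (z ^ 3 + 1))) u"
  have u1: "u ^ 3 + 1 \<noteq> 0" using u(2) by (simp add: eq_neg_iff_add_eq_0)
  have z0: "z \<noteq> 0" if "z ^ 3 = u ^ 3" for z using that u(1) by auto
  have z1: "z ^ 3 + 1 \<noteq> 0" if "z ^ 3 = u ^ 3" for z using that u1 by simp
  have rec: "?W (n + 3) = ?W (n + 2) - x * ?W n" for n
  proof -
    have "cube_orbit_sum \<omega> (\<lambda>z. cubic_root_param z ^ (n + 3) * (z * (z + 1) / (z ^ 3 + 1))) u =
      cube_orbit_sum \<omega> (\<lambda>z. cubic_root_param z ^ (n + 2) * (z * (z + 1) / (z ^ 3 + 1))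
        - x * (cubic_root_param z ^ n * (z * (z + 1) / (z ^ 3 + 1)))) u"
    proof (rule cube_orbit_sum_cong)
      fix z assume z: "z ^ 3 = u ^ 3"
      have "cubic_root_param z ^ 3 = cubic_root_param z ^ 2 - x"
        using cubic_root_param_cubic[OF z0[OF z]] unfolding x_def z .
      hence pw: "cubic_root_param z ^ (n + 3) = cubic_root_param z ^ (n + 2) - x * cubic_root_param z ^ n"
        unfolding power_add by (simp add: right_diff_distrib mult.commute)
      show "cubic_root_param z ^ (n + 3) * (z * (z + 1) / (z ^ 3 + 1)) =
          cubic_root_param z ^ (n + 2) * (z * (z + 1) / (z ^ 3 + 1)) -
          x * (cubic_root_param z ^ n * (z * (z + 1) / (z ^ 3 + 1)))"
        unfolding pw left_diff_distrib mult.assoc ..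
    qed
    thus ?thesis unfolding cube_orbit_sum_def by (simp add: algebra_simps)
  qed
  \<comment> \<open>\<open>?W n\<close> corresponds to the term of index n-1, so this is the term of
    index -1; it gives \<open>?W 3 = 1\<close> from the recurrence without expanding a cube. The
    coefficients supplied here and below come from expanding in 1, z, z^2 with z^3 constant.\<close>
  have W0: "?W 0 = 0"
  proof (subst cube_orbit_sum_eq[of _ _ 0 "1 / (u ^ 3 + 1)" "1 / (u ^ 3 + 1)"])
    fix z assume z: "z ^ 3 = u ^ 3"
    show "cubic_root_param z ^ 0 * (z * (z + 1) / (z ^ 3 + 1)) =
        0 + 1 / (u ^ 3 + 1) * z + 1 / (u ^ 3 + 1) * z\<^sup>2"
      unfolding z by (simp add: distrib_left add_divide_distrib power2_eq_square)
  qed simp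
  have third: "e / 3 / e = 1 / 3" if "e \<noteq> 0" for e :: complex using that by simp
  have W1: "?W 1 = 1"
  proof (subst cube_orbit_sum_eq[of _ _ "1 / 3" "2 / 3 / (u ^ 3 + 1)" "2 / 3 / (u ^ 3 + 1)"])
    fix z assume z: "z ^ 3 = u ^ 3"
    have "cubic_root_param z ^ 1 * (z * (z + 1)) = (z ^ 3 + 1) / 3 + 2 / 3 * z + 2 / 3 * z\<^sup>2"
      using z0[OF z] unfolding cubic_root_param_def by (simp add: field_simps power2_eq_square power3_eq_cube)
    hence "cubic_root_param z ^ 1 * (z * (z + 1)) / (z ^ 3 + 1) =
        ((z ^ 3 + 1) / 3 + 2 / 3 * z + 2 / 3 * z\<^sup>2) / (z ^ 3 + 1)"
      by simp
    thus "cubic_root_param z ^ 1 * (z * (z + 1) / (z ^ 3 + 1)) =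
        1 / 3 + 2 / 3 / (u ^ 3 + 1) * z + 2 / 3 / (u ^ 3 + 1) * z\<^sup>2"
      unfolding quadratic_divide third[OF z1[OF z]] unfolding z by simp
  qed simp
  have W2: "?W 2 = 1"
  proof (subst cube_orbit_sum_eq[of _ _ "1 / 3" "(5 + u ^ 3) / 9 / (u ^ 3 + 1)" "(5 + 1 / u ^ 3) / 9 / (u ^ 3 + 1)"])
    fix z assume z: "z ^ 3 = u ^ 3"
    have "cubic_root_param z ^ 2 * (z * (z + 1)) =
        (z ^ 3 + 1) / 3 + (5 + z ^ 3) / 9 * z + (5 + 1 / z ^ 3) / 9 * z\<^sup>2"
      using z0[OF z] unfolding cubic_root_param_def by (simp add: field_simps power2_eq_square power3_eq_cube)
    hence "cubic_root_param z ^ 2 * (z * (z + 1)) / (z ^ 3 + 1) =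
        ((z ^ 3 + 1) / 3 + (5 + z ^ 3) / 9 * z + (5 + 1 / z ^ 3) / 9 * z\<^sup>2) / (z ^ 3 + 1)"
      by simp
    thus "cubic_root_param z ^ 2 * (z * (z + 1) / (z ^ 3 + 1)) =
        1 / 3 + (5 + u ^ 3) / 9 / (u ^ 3 + 1) * z + (5 + 1 / u ^ 3) / 9 / (u ^ 3 + 1) * z\<^sup>2"
      unfolding quadratic_divide third[OF z1[OF z]] unfolding z by simp
  qed simp
  have "trinomial_sum x n = ?W (n + 1)"
  proof (induction n rule: less_induct)
    case (less n)
    consider "n = 0" | "n = 1" | "n = 2" | m where "n = m + 3"
      by (metis add.commute le_Suc_ex less_2_cases not_less_iff_gr_or_eq One_nat_def Suc_1 Suc_leI
          eval_nat_numeral(3))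
    thus ?case
    proof cases
      case 1
      thus ?thesis using W1 by (simp add: trinomial_sum_def)
    next
      case 2
      thus ?thesis using W2 by (simp add: trinomial_sum_def numeral_2_eq_2)
    next
      case 3
      have "trinomial_sum x 2 = 1" by (simp add: trinomial_sum_def numeral_2_eq_2)
      moreover have "?W 3 = 1" using rec[of 0] unfolding add_0 W0 W2 by simp
      moreover have "n + 1 = 3" using 3 by simp
      ultimately show ?thesis using 3 by simp
    next
      case 4
      have "trinomial_sum x n = trinomial_sum x (m + 2) - x * trinomial_sum x m"
        unfolding 4 by (rule trinomial_sum_rec)
      also have "\<dots> = ?W (m + 2 + 1) - x * ?W (m + 1)"
        using less.IH[of "m + 2"] less.IH[of m] 4 by simp
      also have "\<dots> = ?W (n + 1)" using rec[of "m + 1"] 4 by (simp add: algebra_simps)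
      finally show ?thesis .
    qed
  qed
  thus ?thesis by simp
qed

text \<open>From x = t^2 - t^3 one gets t^3 - 2x = t^2 (3t-2), which cancels the weight 1/(3t-2) and
  leaves a plain power sum of the roots.\<close>

lemma trinomial_sum_closed_form_power_sum:
  assumes u: "u \<noteq> 0" "u ^ 3 \<noteq> - 1"
  defines "x \<equiv> (2 - u ^ 3 - 1 / u ^ 3) / 27"
  shows "trinomial_sum x (n + 3) - 2 * x * trinomial_sum x n =
    cube_orbit_sum \<omega> (\<lambda>z. cubic_root_param z ^ (n + 3)) u"
proof -
  have u1: "u ^ 3 + 1 \<noteq> 0" using u(2) by (simp add: eq_neg_iff_add_eq_0)
  have z0: "z \<noteq> 0" if "z ^ 3 = u ^ 3" for z using that u(1) by auto
  define D :: "complex \<Rightarrow> complex" where "D = (\<lambda>z. z * (z + 1) / (z ^ 3 + 1))"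
  have "trinomial_sum x (n + 3) - 2 * x * trinomial_sum x n =
      cube_orbit_sum \<omega> (\<lambda>z. cubic_root_param z ^ (n + 3 + 1) * D z
        - 2 * x * (cubic_root_param z ^ (n + 1) * D z)) u"
    unfolding trinomial_sum_closed_form[OF u, folded x_def] D_def cube_orbit_sum_def
    by (simp add: algebra_simps)
  also have "\<dots> = cube_orbit_sum \<omega> (\<lambda>z. cubic_root_param z ^ (n + 3)) u"
  proof (rule cube_orbit_sum_cong)
    fix z assume z: "z ^ 3 = u ^ 3"
    define t where "t = cubic_root_param z"
    have t: "x = t ^ 2 - t ^ 3"
      using cubic_root_param_cubic[OF z0[OF z]] unfolding x_def t_def z by simp
    have "(3 * t - 2) * (z * (z + 1)) = z ^ 3 + 1"
      using z0[OF z] unfolding t_def cubic_root_param_def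
      by (simp add: field_simps power2_eq_square power3_eq_cube)
    hence D: "(3 * t - 2) * D z = 1" using u1 z unfolding D_def by simp
    have "t ^ (n + 3 + 1) * D z - 2 * x * (t ^ (n + 1) * D z) = t ^ (n + 3) * ((3 * t - 2) * D z)"
      unfolding t power_add by (simp add: algebra_simps power2_eq_square power3_eq_cube)
    thus "cubic_root_param z ^ (n + 3 + 1) * D z - 2 * x * (cubic_root_param z ^ (n + 1) * D z) =
        cubic_root_param z ^ (n + 3)"
      unfolding D mult_1_right unfolding t_def .
  qed
  finally show ?thesis .
qed

text \<open>The shape left after Frobenius: the squared root is twisted by \<open>a\<close>, its
  weight 1/(3t-2) is not. Of the expansion in 1, z, z^2 only the constant coefficient
  \<open>?A\<close> survives.\<close>

lemma cube_orbit_sum_shift_binomial: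
  assumes u: "u \<noteq> 0" "u ^ 3 \<noteq> - 1" and a: "a ^ 3 = 1"
  shows "cube_orbit_sum \<omega> (\<lambda>z. cubic_root_param (a * z) ^ 2 * (z * (z + 1) / (z ^ 3 + 1))) u =
    (u ^ 3 * (2 * a + a\<^sup>2) + (a + 2 * a\<^sup>2)) / (3 * (u ^ 3 + 1))"
proof -
  have a0: "a \<noteq> 0" using a by auto
  hence ia: "1 / a = a\<^sup>2" using a by (simp add: divide_eq_eq power2_eq_square power3_eq_cube)
  have a4: "a ^ 4 = a" using a by (simp add: power3_eq_cube power4_eq_xxxx)
  let ?A = "(u ^ 3 * (2 * a + a\<^sup>2) + (a + 2 * a\<^sup>2)) / 9"
  let ?B = "(a\<^sup>2 * u ^ 3 + 2 * a\<^sup>2 + 3) / 9" and ?C = "(3 + 2 * a + a / u ^ 3) / 9"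
  have "cubic_root_param (a * z) ^ 2 * (z * (z + 1) / (z ^ 3 + 1)) =
      ?A / (u ^ 3 + 1) + ?B / (u ^ 3 + 1) * z + ?C / (u ^ 3 + 1) * z\<^sup>2" if z: "z ^ 3 = u ^ 3" for z
  proof -
    have z0: "z \<noteq> 0" using z u(1) by auto
    have iz: "1 / z = z\<^sup>2 / u ^ 3"
      using z0 unfolding z[symmetric] by (simp add: field_simps power2_eq_square power3_eq_cube)
    have tz: "cubic_root_param (a * z) = (1 + a * z + a\<^sup>2 / z) / 3"
      unfolding cubic_root_param_def ia[symmetric] by simp
    have "9 * (cubic_root_param (a * z) ^ 2 * (z * (z + 1))) =
        (1 + a * z + a\<^sup>2 / z)\<^sup>2 * (z * (z + 1))"
      unfolding tz by (simp add: power2_eq_square)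
    also have "\<dots> = (z + a * z\<^sup>2 + a\<^sup>2)\<^sup>2 * (1 + 1 / z)"
      using z0 by (simp add: field_simps power2_eq_square)
    also have "\<dots> = (z ^ 3 * (2 * a + a\<^sup>2) + (a ^ 4 + 2 * a\<^sup>2)) +
       (2 * a\<^sup>2 + 1 + 2 * a ^ 3 + a\<^sup>2 * z ^ 3) * z + (1 + 2 * a ^ 3 + 2 * a) * z\<^sup>2 + a ^ 4 * (1 / z)"
      using z0 by (simp add: field_simps power2_eq_square power3_eq_cube power4_eq_xxxx)
    also have "\<dots> = 9 * (?A + ?B * z + ?C * z\<^sup>2)"
      unfolding iz z a a4 by (simp add: algebra_simps add_divide_distrib diff_divide_distrib)
    finally have "cubic_root_param (a * z) ^ 2 * (z * (z + 1)) = ?A + ?B * z + ?C * z\<^sup>2"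
      unfolding mult_cancel_left by (elim disjE) auto
    hence "cubic_root_param (a * z) ^ 2 * (z * (z + 1)) / (u ^ 3 + 1) =
        (?A + ?B * z + ?C * z\<^sup>2) / (u ^ 3 + 1)" by simp
    thus ?thesis unfolding quadratic_divide z by simp
  qed
  note sum = cube_orbit_sum_eq[of u, OF this]
  have "3 * (y / 9 / e) = y / (3 * e)" for y e :: complex by simp
  from sum[unfolded this] show ?thesis .
qed

text \<open>As for the binomial sum, with the weight 1/t: here t = (z^2 + z + 1)/(3z) = (z^3 -
  1)/(3z(z - 1)).\<close>

lemma cube_orbit_sum_shift_catalan:
  assumes u: "u \<noteq> 0" "u ^ 3 \<noteq> 1" and a: "a ^ 3 = 1"
  shows "cube_orbit_sum \<omega> (\<lambda>z. cubic_root_param (a * z) ^ 2 * (3 * z * (z - 1) / (z ^ 3 - 1))) u =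
    (u ^ 3 * (2 * a - a\<^sup>2) + (a - 2 * a\<^sup>2)) / (u ^ 3 - 1)"
proof -
  have a0: "a \<noteq> 0" using a by auto
  hence ia: "1 / a = a\<^sup>2" using a by (simp add: divide_eq_eq power2_eq_square power3_eq_cube)
  have a4: "a ^ 4 = a" using a by (simp add: power3_eq_cube power4_eq_xxxx)
  let ?A = "(u ^ 3 * (2 * a - a\<^sup>2) + (a - 2 * a\<^sup>2)) / 3"
  let ?B = "(a\<^sup>2 * u ^ 3 + 2 * a\<^sup>2 - 3) / 3" and ?C = "(3 - 2 * a - a / u ^ 3) / 3"
  have "cubic_root_param (a * z) ^ 2 * (3 * z * (z - 1) / (z ^ 3 - 1)) =
      ?A / (u ^ 3 - 1) + ?B / (u ^ 3 - 1) * z + ?C / (u ^ 3 - 1) * z\<^sup>2" if z: "z ^ 3 = u ^ 3" for z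
  proof -
    have z0: "z \<noteq> 0" using z u(1) by auto
    have iz: "1 / z = z\<^sup>2 / u ^ 3"
      using z0 unfolding z[symmetric] by (simp add: field_simps power2_eq_square power3_eq_cube)
    have tz: "cubic_root_param (a * z) = (1 + a * z + a\<^sup>2 / z) / 3"
      unfolding cubic_root_param_def ia[symmetric] by simp
    have "3 * (cubic_root_param (a * z) ^ 2 * (3 * z * (z - 1))) =
        (1 + a * z + a\<^sup>2 / z)\<^sup>2 * (z * (z - 1))"
      unfolding tz by (simp add: power2_eq_square)
    also have "\<dots> = (z + a * z\<^sup>2 + a\<^sup>2)\<^sup>2 * (1 - 1 / z)"
      using z0 by (simp add: field_simps power2_eq_square)
    also have "\<dots> = (z ^ 3 * (2 * a - a\<^sup>2) + (a ^ 4 - 2 * a\<^sup>2)) +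
       (2 * a\<^sup>2 - 1 - 2 * a ^ 3 + a\<^sup>2 * z ^ 3) * z + (1 + 2 * a ^ 3 - 2 * a) * z\<^sup>2 - a ^ 4 * (1 / z)"
      using z0 by (simp add: field_simps power2_eq_square power3_eq_cube power4_eq_xxxx)
    also have "\<dots> = 3 * (?A + ?B * z + ?C * z\<^sup>2)"
      unfolding iz z a a4 by (simp add: algebra_simps add_divide_distrib diff_divide_distrib)
    finally have "cubic_root_param (a * z) ^ 2 * (3 * z * (z - 1)) = ?A + ?B * z + ?C * z\<^sup>2"
      unfolding mult_cancel_left by (elim disjE) auto
    hence "cubic_root_param (a * z) ^ 2 * (3 * z * (z - 1)) / (u ^ 3 - 1) =
        (?A + ?B * z + ?C * z\<^sup>2) / (u ^ 3 - 1)" by simp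
    thus ?thesis unfolding quadratic_divide z by simp
  qed
  note sum = cube_orbit_sum_eq[of u, OF this]
  have "3 * (y / 3 / e) = y / e" for y e :: complex by simp
  from sum[unfolded this] show ?thesis .
qed

end

subsection \<open>Cubic Gauss and Jacobi sums\<close>

text \<open>The residue \<open>w\<close> is a primitive cube root of unity modulo q. Fixing it
  selects a prime of Z[\<omega>] above q, the kernel of \<omega> -> w, and thereby one of the two
  conjugate cubic characters.\<close>

locale cubic_character =
  fixes q :: nat and w :: int
  assumes q: "prime q" and q_mod_3: "q mod 3 = 1" and w: "int q dvd w\<^sup>2 + w + 1"
begin

definition n :: nat where "n = (q - 1) div 3"
definition \<omega> :: complex where "\<omega> = cis (2 * pi / 3)"
definition \<zeta> :: "int \<Rightarrow> complex" where "\<zeta> a = cis (2 * pi * of_int a / of_nat q)"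
text \<open>The index \<open>i\<close> exists for every \<open>a\<close> prime to \<open>q\<close> and is unique modulo 3.\<close>

definition \<chi> :: "int \<Rightarrow> complex" where
  "\<chi> a = (if int q dvd a then 0 else \<omega> ^ (SOME i. [a ^ n = w ^ i] (mod int q)))"

lemma q_gt_3: "q > 3"
proof -
  have "q \<ge> 2" using q by (rule prime_ge_2_nat)
  moreover have "q \<noteq> 2" "q \<noteq> 3" using q_mod_3 by auto
  ultimately show ?thesis by auto
qed

lemma prime_int_q: "prime (int q)" using q by simp

lemma q_eq: "q = 3 * n + 1"
  using q_mod_3 q_gt_3 unfolding n_def by presburger

lemma n_pos: "n > 0" using q_eq q_gt_3 by simp

lemma q_odd: "odd q"
  using prime_odd_nat[OF q] q_gt_3 by simp

lemma n_even: "even n"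
  using q_odd q_eq by presburger

lemma not_q_dvd_3: "\<not> int q dvd 3"
  using q_gt_3 zdvd_imp_le[of "int q" 3] by auto

lemma omega_poly: "\<omega>\<^sup>2 + \<omega> + 1 = 0"
proof -
  have eq: "\<omega> = Complex (- 1 / 2) (sqrt 3 / 2)"
    unfolding \<omega>_def by (simp add: complex_eq_iff cos_120 sin_120)
  show ?thesis unfolding eq by (simp add: complex_eq_iff power2_eq_square)
qed

lemma omega_power_3: "\<omega> ^ 3 = 1" by (rule omega_cube[OF omega_poly])

lemma omega_power_mod: "\<omega> ^ i = \<omega> ^ (i mod 3)"
proof -
  have "\<omega> ^ i = \<omega> ^ (3 * (i div 3) + i mod 3)" by simp
  thus ?thesis by (simp only: power_add power_mult omega_power_3 power_one mult_1_left)
qed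

lemma omega_ne_1: "\<omega> \<noteq> 1"
  using omega_poly by auto

lemma w_power_mod: "[w ^ i = w ^ (i mod 3)] (mod int q)"
proof -
  have "w ^ 3 - 1 = (w\<^sup>2 + w + 1) * (w - 1)" by (simp add: algebra_simps power2_eq_square power3_eq_cube)
  hence "[w ^ 3 = 1] (mod int q)" unfolding cong_iff_dvd_diff using w by simp
  hence "[(w ^ 3) ^ (i div 3) * w ^ (i mod 3) = 1 ^ (i div 3) * w ^ (i mod 3)] (mod int q)"
    by (intro cong_mult cong_pow cong_refl)
  thus ?thesis by (simp flip: power_mult power_add)
qed

text \<open>If two of 1, w, w^2 agreed modulo q, then q would divide 3: each case writes 3 as a
  combination of w^2 + w + 1 and the difference of the two powers.\<close>

lemma w_power_inj:
  assumes "[w ^ i = w ^ j] (mod int q)"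
  shows "i mod 3 = j mod 3"
proof -
  have *: False if "[w ^ a = w ^ b] (mod int q)" "a < b" "b < 3" for a b :: nat
  proof -
    have d: "int q dvd w ^ b - w ^ a" using that(1) by (simp add: cong_iff_dvd_diff dvd_diff_commute)
    have "a = 0 \<and> b = 1 \<or> a = 0 \<and> b = 2 \<or> a = 1 \<and> b = 2" using that(2,3) by presburger
    then consider "a = 0" "b = 1" | "a = 0" "b = 2" | "a = 1" "b = 2" by blast
    thus False
    proof cases
      case 1
      have "(w\<^sup>2 + w + 1) - (w ^ b - w ^ a) * (w + 2) = 3"
        using 1 by (simp add: algebra_simps power2_eq_square)
      thus False using w d not_q_dvd_3 by (metis dvd_diff dvd_mult2)
    next
      case 2
      have "(w\<^sup>2 + w + 1) - ((w\<^sup>2 + w + 1) - (w ^ b - w ^ a)) * (w - 1) = 3"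
        using 2 by (simp add: algebra_simps power2_eq_square)
      thus False using w d not_q_dvd_3 by (metis dvd_diff dvd_mult2)
    next
      case 3
      have "4 * (w\<^sup>2 + w + 1) - ((w\<^sup>2 + w + 1) - (w ^ b - w ^ a)) * (2 * w + 1) = 3"
        using 3 by (simp add: algebra_simps power2_eq_square)
      thus False using w d not_q_dvd_3 by (metis dvd_diff dvd_mult dvd_mult2)
    qed
  qed
  have "[w ^ (i mod 3) = w ^ (j mod 3)] (mod int q)"
    using assms w_power_mod cong_sym cong_trans by meson
  thus ?thesis
    using *[of "i mod 3" "j mod 3"] *[of "j mod 3" "i mod 3"] cong_sym
    by (metis linorder_neqE_nat mod_less_divisor zero_less_numeral)
qed

lemma fermat: "\<not> int q dvd a \<Longrightarrow> [a ^ (q - 1) = 1] (mod int q)"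
proof -
  assume a: "\<not> int q dvd a"
  define b where "b = nat (a mod int q)"
  have b: "int b = a mod int q" unfolding b_def using q_gt_3 by simp
  have "\<not> q dvd b"
    using a b by (metis dvd_mod_iff dvd_refl int_dvd_int_iff)
  hence "[b ^ (q - 1) = 1] (mod q)" using q fermat_theorem by blast
  hence "[int (b ^ (q - 1)) = int 1] (mod int q)" unfolding cong_int_iff .
  hence "[(a mod int q) ^ (q - 1) = 1] (mod int q)" using b by simp
  moreover have "[a ^ (q - 1) = (a mod int q) ^ (q - 1)] (mod int q)"
    by (intro cong_pow) (simp add: cong_def)
  ultimately show ?thesis using cong_trans by blast
qed

lemma character_index_exists:
  assumes "\<not> int q dvd a"
  shows "\<exists>i. [a ^ n = w ^ i] (mod int q)"
proof -
  define e where "e = a ^ n"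
  have "q - 1 = n * 3" using q_eq by simp
  hence "[e ^ 3 = 1] (mod int q)"
    using fermat[OF assms] unfolding e_def by (simp flip: power_mult)
  \<comment> \<open>The factorization of e^3 - 1 modulo q, with -1 - w in place of w^2.\<close>
  moreover have "(e - 1) * ((e - w) * (e + 1 + w)) = (e ^ 3 - 1) - (w\<^sup>2 + w + 1) * (e - 1)"
    by (simp add: algebra_simps power2_eq_square power3_eq_cube)
  ultimately have "int q dvd (e - 1) * ((e - w) * (e + 1 + w))"
    using w by (simp add: cong_iff_dvd_diff)
  then consider "int q dvd e - 1" | "int q dvd e - w" | "int q dvd e + 1 + w"
    using prime_int_q prime_dvd_mult_iff by blast
  thus ?thesis
  proof cases
    case 1
    thus ?thesis unfolding e_def by (intro exI[of _ 0]) (simp add: cong_iff_dvd_diff)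
  next
    case 2
    thus ?thesis unfolding e_def by (intro exI[of _ 1]) (simp add: cong_iff_dvd_diff)
  next
    case 3
    have "e - w\<^sup>2 = (e + 1 + w) - (w\<^sup>2 + w + 1)" by simp
    hence "int q dvd e - w\<^sup>2" using 3 w by (metis dvd_diff)
    thus ?thesis unfolding e_def by (intro exI[of _ 2]) (simp add: cong_iff_dvd_diff)
  qed
qed

lemma chi_eqI:
  assumes "\<not> int q dvd a" "[a ^ n = w ^ i] (mod int q)"
  shows "\<chi> a = \<omega> ^ i"
proof -
  define j where "j = (SOME i. [a ^ n = w ^ i] (mod int q))"
  have "[a ^ n = w ^ j] (mod int q)" unfolding j_def using assms(2) by (rule someI)
  hence "[w ^ j = w ^ i] (mod int q)" using assms(2) cong_sym cong_trans by blast
  hence "\<omega> ^ j = \<omega> ^ i" using w_power_inj omega_power_mod by metis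
  thus ?thesis using assms(1) unfolding \<chi>_def j_def by simp
qed

lemma chi_E:
  assumes "\<not> int q dvd a"
  obtains i where "[a ^ n = w ^ i] (mod int q)" "\<chi> a = \<omega> ^ i"
  using character_index_exists[OF assms] chi_eqI[OF assms] by blast

lemma chi_0: "int q dvd a \<Longrightarrow> \<chi> a = 0"
  by (simp add: \<chi>_def)

lemma chi_mult: "\<chi> (a * b) = \<chi> a * \<chi> b"
proof (cases "int q dvd a \<or> int q dvd b")
  case True
  thus ?thesis by (auto simp: chi_0)
next
  case False
  then obtain i j where "[a ^ n = w ^ i] (mod int q)" "\<chi> a = \<omega> ^ i"
    "[b ^ n = w ^ j] (mod int q)" "\<chi> b = \<omega> ^ j"
    by (metis chi_E)
  moreover have "\<not> int q dvd a * b" using False prime_int_q by (simp add: prime_dvd_mult_iff)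
  ultimately show ?thesis
    using chi_eqI[of "a * b" "i + j"] cong_mult[of "a ^ n" "w ^ i" "int q" "b ^ n" "w ^ j"]
    by (simp add: power_mult_distrib power_add)
qed

lemma chi_cong:
  assumes "[a = b] (mod int q)"
  shows "\<chi> a = \<chi> b"
proof (cases "int q dvd a")
  case True
  hence "int q dvd b" using assms cong_dvd_iff by blast
  thus ?thesis using True by (simp add: chi_0)
next
  case False
  hence "\<not> int q dvd b" using assms cong_dvd_iff by blast
  then obtain i where i: "[b ^ n = w ^ i] (mod int q)" "\<chi> b = \<omega> ^ i" by (rule chi_E)
  have "[a ^ n = w ^ i] (mod int q)" using cong_trans[OF cong_pow[OF assms] i(1)] .
  thus ?thesis using chi_eqI[OF False] i(2) by simp
qed

lemma chi_cube: "\<not> int q dvd a \<Longrightarrow> \<chi> a ^ 3 = 1"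
  by (erule chi_E) (metis mult.commute omega_power_3 power_mult power_one)

lemma chi_1: "\<chi> 1 = 1"
  using chi_eqI[of 1 0] q_gt_3 by (simp add: zdvd1_eq)

lemma chi_uminus: "\<chi> (- a) = \<chi> a"
proof -
  have "\<chi> (- 1) = 1"
    using chi_eqI[of "- 1" 0] q_gt_3 n_even by (simp add: zdvd1_eq)
  thus ?thesis using chi_mult[of "- 1" a] by simp
qed

lemma cnj_omega: "cnj \<omega> = \<omega>\<^sup>2"
proof -
  have "\<omega> * cnj \<omega> = 1" unfolding \<omega>_def by (simp add: cis_cnj cis_mult)
  hence "\<omega>\<^sup>2 * (\<omega> * cnj \<omega>) = \<omega>\<^sup>2" by simp
  moreover have "\<omega>\<^sup>2 * (\<omega> * cnj \<omega>) = \<omega> ^ 3 * cnj \<omega>"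
    by (simp add: power2_eq_square power3_eq_cube)
  ultimately show ?thesis using omega_power_3 by simp
qed

lemma cnj_chi: "cnj (\<chi> a) = \<chi> a ^ 2"
proof (cases "int q dvd a")
  case False
  then obtain i where "\<chi> a = \<omega> ^ i" by (rule chi_E)
  thus ?thesis by (simp add: cnj_omega flip: power_mult) (simp add: mult.commute)
qed (simp add: chi_0)

lemma primitive_root:
  obtains g :: nat where "\<not> int q dvd int g" "\<And>j. [int g ^ j = 1] (mod int q) \<Longrightarrow> q - 1 dvd j"
proof -
  obtain g where "residue_primroot q g"
    using prime_primitive_root_exists[of q] q q_gt_3 by auto
  hence g: "coprime q g" "ord q g = q - 1"
    using q by (auto simp: residue_primroot_def totient_prime)
  have "\<not> int q dvd int g"
    using g(1) q_gt_3 coprime_common_divisor[of q g q] by auto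
  moreover have "q - 1 dvd j" if "[int g ^ j = 1] (mod int q)" for j
  proof -
    have "[int (g ^ j) = int 1] (mod int q)" using that by simp
    hence "[g ^ j = 1] (mod q)" unfolding cong_int_iff .
    thus ?thesis using g(2) ord_divides by metis
  qed
  ultimately show ?thesis using that by blast
qed

lemma chi_nontrivial:
  obtains g where "\<not> int q dvd g" "\<chi> g \<noteq> 1"
proof -
  obtain g where qg: "\<not> int q dvd int g" and g: "\<And>j. [int g ^ j = 1] (mod int q) \<Longrightarrow> q - 1 dvd j"
    by (rule primitive_root) blast
  have "\<chi> (int g) \<noteq> 1"
  proof
    assume *: "\<chi> (int g) = 1"
    obtain i where i: "[int g ^ n = w ^ i] (mod int q)" "\<chi> (int g) = \<omega> ^ i" using qg by (rule chi_E)
    have "\<omega> ^ (i mod 3) = 1" using i(2) * omega_power_mod by metis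
    moreover have "\<omega>\<^sup>2 \<noteq> 1" using omega_poly omega_power_3 omega_ne_1
      by (metis mult_1_left power2_eq_square power3_eq_cube)
    moreover have "i mod 3 = 0 \<or> i mod 3 = 1 \<or> i mod 3 = 2" by linarith
    ultimately have "i mod 3 = 0" using omega_ne_1 by auto
    hence "[w ^ i = 1] (mod int q)" using w_power_mod[of i] by simp
    hence "[int g ^ n = 1] (mod int q)" using i(1) cong_trans by blast
    hence "q - 1 dvd n" by (rule g)
    hence "q - 1 \<le> n" using n_pos by (rule dvd_imp_le)
    thus False using n_pos q_eq by simp
  qed
  thus ?thesis using that qg by blast
qed

section \<open>Gauss and Jacobi sums over the residues modulo q\<close>

definition Zq :: "int set" where "Zq = {0..<int q}"

lemma finite_Zq [simp]: "finite Zq" by (simp add: Zq_def)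

lemma q_pos: "int q > 0" using q_gt_3 by simp

lemma sum_Zq_reindex:
  fixes f :: "int \<Rightarrow> 'b :: comm_monoid_add"
  assumes f: "\<And>a b. [a = b] (mod int q) \<Longrightarrow> f a = f b"
    and h: "\<And>a b. [h a = h b] (mod int q) \<Longrightarrow> [a = b] (mod int q)"
  shows "(\<Sum>a\<in>Zq. f (h a)) = (\<Sum>a\<in>Zq. f a)"
proof -
  define g where "g a = h a mod int q" for a
  have sub: "g ` Zq \<subseteq> Zq" unfolding g_def Zq_def using q_pos by auto
  have inj: "inj_on g Zq"
  proof (rule inj_onI)
    fix a b assume ab: "a \<in> Zq" "b \<in> Zq" "g a = g b"
    hence "[a = b] (mod int q)" using h[of a b] unfolding g_def cong_def by simp
    thus "a = b" using ab unfolding Zq_def cong_def by simp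
  qed
  have "bij_betw g Zq Zq"
    using inj endo_inj_surj[OF finite_Zq sub inj] by (simp add: bij_betw_def)
  hence "(\<Sum>a\<in>Zq. f (g a)) = (\<Sum>a\<in>Zq. f a)" by (rule sum.reindex_bij_betw)
  moreover have "f (g a) = f (h a)" for a unfolding g_def by (rule f) (simp add: cong_def)
  ultimately show ?thesis by simp
qed

lemma cong_mult_cancel_q:
  "\<not> int q dvd c \<Longrightarrow> [c * a = c * b] (mod int q) \<Longrightarrow> [a = b] (mod int q)"
  using prime_int_q by (metis cong_mult_lcancel coprime_commute prime_imp_coprime)

lemma sum_Zq_mult:
  fixes f :: "int \<Rightarrow> 'b :: comm_monoid_add"
  assumes "\<And>a b. [a = b] (mod int q) \<Longrightarrow> f a = f b" "\<not> int q dvd c"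
  shows "(\<Sum>a\<in>Zq. f (c * a)) = (\<Sum>a\<in>Zq. f a)"
  using assms(1) by (rule sum_Zq_reindex) (use cong_mult_cancel_q[OF assms(2)] in auto)

lemma sum_Zq_shift:
  fixes f :: "int \<Rightarrow> 'b :: comm_monoid_add"
  assumes "\<And>a b. [a = b] (mod int q) \<Longrightarrow> f a = f b"
  shows "(\<Sum>a\<in>Zq. f (a + c)) = (\<Sum>a\<in>Zq. f a)"
  using assms by (rule sum_Zq_reindex) (auto simp: cong_add_rcancel)

lemma zeta_add: "\<zeta> (a + b) = \<zeta> a * \<zeta> b"
  by (simp add: \<zeta>_def cis_mult add_divide_distrib distrib_left)

lemma zeta_0: "\<zeta> 0 = 1" by (simp add: \<zeta>_def)

lemma cnj_zeta: "cnj (\<zeta> a) = \<zeta> (- a)" by (simp add: \<zeta>_def cis_cnj)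

lemma zeta_eq_1_iff: "\<zeta> a = 1 \<longleftrightarrow> int q dvd a"
proof
  assume "\<zeta> a = 1"
  hence "cos (2 * pi * of_int a / of_nat q) = 1"
    unfolding \<zeta>_def by (simp add: complex_eq_iff)
  then obtain k :: int where "2 * pi * of_int a / of_nat q = of_int k * 2 * pi"
    using cos_one_2pi_int by blast
  hence "of_int a = (of_int (k * int q) :: real)" using q_pos by (simp add: field_simps)
  thus "int q dvd a" unfolding of_int_eq_iff by simp
next
  assume "int q dvd a"
  then obtain k where "a = int q * k" by blast
  hence eq: "2 * pi * of_int a / of_nat q = 2 * pi * of_int k" using q_pos by simp
  show "\<zeta> a = 1" unfolding \<zeta>_def eq by simp
qed

lemma zeta_cong:
  assumes "[a = b] (mod int q)"
  shows "\<zeta> a = \<zeta> b"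
proof -
  have "\<zeta> (a - b) = 1" using assms by (simp add: zeta_eq_1_iff cong_iff_dvd_diff)
  thus ?thesis using zeta_add[of "a - b" b] by simp
qed

lemma zeta_power: "\<zeta> a ^ k = \<zeta> (int k * a)"
  by (induction k) (auto simp: zeta_0 zeta_add distrib_right)

lemma sum_zeta: "(\<Sum>b\<in>Zq. \<zeta> (b * c)) = (if int q dvd c then of_nat q else 0)"
proof (cases "int q dvd c")
  case True
  hence "\<zeta> (b * c) = 1" for b by (simp add: zeta_eq_1_iff)
  thus ?thesis using True by (simp add: Zq_def)
next
  case False
  have "(\<Sum>b\<in>Zq. \<zeta> ((b + 1) * c)) = (\<Sum>b\<in>Zq. \<zeta> (b * c))"
    by (rule sum_Zq_shift[where f = "\<lambda>b. \<zeta> (b * c)"]) (intro zeta_cong cong_scalar_right)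
  moreover have "(\<Sum>b\<in>Zq. \<zeta> ((b + 1) * c)) = \<zeta> c * (\<Sum>b\<in>Zq. \<zeta> (b * c))"
    unfolding distrib_right zeta_add sum_distrib_left by (simp add: mult.commute)
  ultimately have "(\<zeta> c - 1) * (\<Sum>b\<in>Zq. \<zeta> (b * c)) = 0" by (simp add: algebra_simps)
  thus ?thesis using False zeta_eq_1_iff[of c] by simp
qed

lemma sum_chi: "(\<Sum>a\<in>Zq. \<chi> a) = 0"
proof -
  obtain g where g: "\<not> int q dvd g" "\<chi> g \<noteq> 1" by (rule chi_nontrivial)
  have "(\<Sum>a\<in>Zq. \<chi> (g * a)) = (\<Sum>a\<in>Zq. \<chi> a)"
    by (rule sum_Zq_mult) (use chi_cong g in auto)
  hence "(\<chi> g - 1) * (\<Sum>a\<in>Zq. \<chi> a) = 0"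
    by (simp add: chi_mult sum_distrib_left[symmetric] left_diff_distrib)
  thus ?thesis using g(2) by simp
qed

definition G :: complex where "G = (\<Sum>a\<in>Zq. \<chi> a * \<zeta> a)"
definition J :: complex where "J = (\<Sum>a\<in>Zq. \<chi> a * \<chi> (1 - a))"

text \<open>Conjugation sends \<zeta>(a) to \<zeta>(-a); as \<chi>(-1) = 1, substituting -a restores
  \<zeta>(a) without a sign.\<close>

lemma cnj_G: "cnj G = (\<Sum>a\<in>Zq. cnj (\<chi> a) * \<zeta> a)"
proof -
  have "cnj G = (\<Sum>a\<in>Zq. cnj (\<chi> (- 1 * a)) * \<zeta> (- 1 * a))"
    by (simp add: G_def cnj_zeta chi_uminus)
  also have "\<dots> = (\<Sum>a\<in>Zq. cnj (\<chi> a) * \<zeta> a)"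
  proof (rule sum_Zq_mult)
    show "\<not> int q dvd - 1" using q_gt_3 by (simp add: zdvd1_eq)
    show "cnj (\<chi> a) * \<zeta> a = cnj (\<chi> b) * \<zeta> b" if "[a = b] (mod int q)" for a b
      using chi_cong[OF that] zeta_cong[OF that] by simp
  qed
  finally show ?thesis .
qed

lemma G_mult_cnj: "G * cnj G = of_nat q"
proof -
  have "G * cnj G = (\<Sum>b\<in>Zq. \<Sum>a\<in>Zq. \<chi> a * cnj (\<chi> b) * \<zeta> (a - b))"
    unfolding G_def cnj_sum sum_product
    by (subst sum.swap) (simp add: cnj_zeta zeta_add[of _ "- _", simplified] mult_ac)
  \<comment> \<open>Substitution a = bc. For b = 0 both inner sums vanish, the new one because the
    values of \<chi> sum to 0; so b can run over all residues and orthogonality applies.\<close>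
  also have "\<dots> = (\<Sum>b\<in>Zq. \<Sum>c\<in>Zq. \<chi> c * \<zeta> (b * (c - 1)))"
  proof (rule sum.cong)
    fix b assume "b \<in> Zq"
    show "(\<Sum>a\<in>Zq. \<chi> a * cnj (\<chi> b) * \<zeta> (a - b)) = (\<Sum>c\<in>Zq. \<chi> c * \<zeta> (b * (c - 1)))"
    proof (cases "int q dvd b")
      case True
      hence "\<zeta> (b * (c - 1)) = 1" for c by (simp add: zeta_eq_1_iff)
      thus ?thesis using True sum_chi by (simp add: chi_0)
    next
      case False
      have "(\<Sum>a\<in>Zq. \<chi> a * cnj (\<chi> b) * \<zeta> (a - b)) =
          (\<Sum>c\<in>Zq. \<chi> (b * c) * cnj (\<chi> b) * \<zeta> (b * c - b))"
      proof (rule sum_Zq_mult[symmetric, OF _ False])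
        fix x y assume xy: "[x = y] (mod int q)"
        show "\<chi> x * cnj (\<chi> b) * \<zeta> (x - b) = \<chi> y * cnj (\<chi> b) * \<zeta> (y - b)"
          using chi_cong[OF xy] zeta_cong[OF cong_diff[OF xy cong_refl[of b]]] by simp
      qed
      also have "\<dots> = (\<Sum>c\<in>Zq. \<chi> c * \<zeta> (b * (c - 1)))"
      proof (rule sum.cong)
        fix c
        have "\<chi> (b * c) * cnj (\<chi> b) = \<chi> c"
          using chi_cube[OF False] unfolding chi_mult cnj_chi
          by (simp add: power2_eq_square power3_eq_cube mult_ac)
        thus "\<chi> (b * c) * cnj (\<chi> b) * \<zeta> (b * c - b) = \<chi> c * \<zeta> (b * (c - 1))"
          by (simp add: right_diff_distrib)
      qed simp
      finally show ?thesis .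
    qed
  qed simp
  also have "\<dots> = (\<Sum>c\<in>Zq. \<chi> c * (\<Sum>b\<in>Zq. \<zeta> (b * (c - 1))))"
    by (subst sum.swap) (simp add: sum_distrib_left)
  also have "\<dots> = (\<Sum>c\<in>Zq. if c = 1 then of_nat q else 0)"
  proof (rule sum.cong)
    fix c assume "c \<in> Zq"
    hence "int q dvd c - 1 \<longleftrightarrow> c = 1"
      using q_gt_3 unfolding Zq_def mod_eq_dvd_iff[symmetric] by auto
    thus "\<chi> c * (\<Sum>b\<in>Zq. \<zeta> (b * (c - 1))) = (if c = 1 then of_nat q else 0)"
      unfolding sum_zeta by (auto simp: chi_1)
  qed simp
  also have "\<dots> = of_nat q" using q_gt_3 by (simp add: Zq_def)
  finally show ?thesis .
qed

text \<open>Terms are grouped by s = a + b. For s prime to q, scaling by s yields J \<chi>(s)^2,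
  which is J times the conjugate of \<chi>(s); for s = 0 the inner sum is that of the conjugate
  character, hence 0.\<close>

lemma G_square: "G ^ 2 = J * cnj G"
proof -
  have "G ^ 2 = (\<Sum>a\<in>Zq. \<Sum>b\<in>Zq. \<chi> a * \<chi> b * \<zeta> (a + b))"
    unfolding power2_eq_square G_def sum_product by (simp add: zeta_add mult_ac)
  also have "\<dots> = (\<Sum>a\<in>Zq. \<Sum>s\<in>Zq. \<chi> a * \<chi> (s - a) * \<zeta> s)"
  proof (rule sum.cong)
    fix a
    have "(\<Sum>b\<in>Zq. \<chi> a * \<chi> (b + a - a) * \<zeta> (b + a)) = (\<Sum>s\<in>Zq. \<chi> a * \<chi> (s - a) * \<zeta> s)"
    proof (rule sum_Zq_shift)
      fix x y assume xy: "[x = y] (mod int q)"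
      show "\<chi> a * \<chi> (x - a) * \<zeta> x = \<chi> a * \<chi> (y - a) * \<zeta> y"
        using zeta_cong[OF xy] chi_cong[OF cong_diff[OF xy cong_refl[of a]]] by simp
    qed
    thus "(\<Sum>b\<in>Zq. \<chi> a * \<chi> b * \<zeta> (a + b)) = (\<Sum>s\<in>Zq. \<chi> a * \<chi> (s - a) * \<zeta> s)"
      by (simp add: add.commute)
  qed simp
  also have "\<dots> = (\<Sum>s\<in>Zq. (\<Sum>a\<in>Zq. \<chi> a * \<chi> (s - a)) * \<zeta> s)"
    by (subst sum.swap) (simp add: sum_distrib_right)
  also have "\<dots> = (\<Sum>s\<in>Zq. J * (cnj (\<chi> s) * \<zeta> s))"
  proof (rule sum.cong)
    fix s
    have "(\<Sum>a\<in>Zq. \<chi> a * \<chi> (s - a)) = J * cnj (\<chi> s)"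
    proof (cases "int q dvd s")
      case True
      have "\<chi> (s - a) = \<chi> a" for a
      proof -
        have "[s - a = - a] (mod int q)" using True by (simp add: cong_iff_dvd_diff)
        thus ?thesis using chi_cong chi_uminus by metis
      qed
      hence "(\<Sum>a\<in>Zq. \<chi> a * \<chi> (s - a)) = (\<Sum>a\<in>Zq. cnj (\<chi> a))"
        unfolding cnj_chi by (simp add: power2_eq_square)
      also have "\<dots> = cnj (\<Sum>a\<in>Zq. \<chi> a)" by simp
      finally show ?thesis using sum_chi True by (simp add: chi_0)
    next
      case False
      have "(\<Sum>a\<in>Zq. \<chi> a * \<chi> (s - a)) = (\<Sum>a\<in>Zq. \<chi> (s * a) * \<chi> (s - s * a))"
      proof (rule sum_Zq_mult[symmetric, OF _ False])
        fix x y assume xy: "[x = y] (mod int q)"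
        show "\<chi> x * \<chi> (s - x) = \<chi> y * \<chi> (s - y)"
          using chi_cong[OF xy] chi_cong[OF cong_diff[OF cong_refl[of s] xy]] by simp
      qed
      also have "\<dots> = (\<Sum>a\<in>Zq. \<chi> s ^ 2 * (\<chi> a * \<chi> (1 - a)))"
      proof (rule sum.cong)
        fix a
        have "s - s * a = s * (1 - a)" by (simp add: right_diff_distrib)
        thus "\<chi> (s * a) * \<chi> (s - s * a) = \<chi> s ^ 2 * (\<chi> a * \<chi> (1 - a))"
          by (simp add: chi_mult power2_eq_square)
      qed simp
      finally show ?thesis unfolding J_def cnj_chi by (simp add: sum_distrib_left mult.commute)
    qed
    thus "(\<Sum>a\<in>Zq. \<chi> a * \<chi> (s - a)) * \<zeta> s = J * (cnj (\<chi> s) * \<zeta> s)" by simp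
  qed simp
  also have "\<dots> = J * cnj G" unfolding cnj_G by (simp add: sum_distrib_left)
  finally show ?thesis .
qed

lemma G_cube: "G ^ 3 = of_nat q * J"
proof -
  have "G ^ 3 = G * G ^ 2" by (simp add: power2_eq_square power3_eq_cube)
  also have "\<dots> = J * (G * cnj G)" unfolding G_square by simp
  finally show ?thesis unfolding G_mult_cnj by simp
qed

lemma J_norm: "J * cnj J = of_nat q"
proof -
  have "cnj (G ^ 3) = cnj (of_nat q * J)" unfolding G_cube ..
  hence "(cnj G) ^ 3 = of_nat q * cnj J" by simp
  hence "(G * cnj G) ^ 3 = of_nat q * J * (of_nat q * cnj J)"
    unfolding power_mult_distrib G_cube by simp
  hence "of_nat q ^ 2 * (J * cnj J) = of_nat q ^ 2 * (of_nat q :: complex)"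
    unfolding G_mult_cnj by (auto simp: power2_eq_square power3_eq_cube mult_ac)
  thus ?thesis using q_pos by simp
qed

section \<open>The Jacobi sum modulo q\<close>

lemma power_sum_Zq:
  assumes "0 < j" "j < q - 1"
  shows "int q dvd (\<Sum>a\<in>Zq. a ^ j)"
proof -
  obtain g where qg: "\<not> int q dvd int g" and g: "\<And>j. [int g ^ j = 1] (mod int q) \<Longrightarrow> q - 1 dvd j"
    by (rule primitive_root) blast
  have gj: "\<not> int q dvd int g ^ j - 1"
  proof
    assume "int q dvd int g ^ j - 1"
    hence "q - 1 dvd j" by (intro g) (simp add: cong_iff_dvd_diff)
    hence "q - 1 \<le> j" using assms(1) by (rule dvd_imp_le)
    thus False using assms(2) by simp
  qed
  have "(\<Sum>a\<in>Zq. (int g * a) ^ j mod int q) = (\<Sum>a\<in>Zq. a ^ j mod int q)"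
  proof (rule sum_Zq_mult[OF _ qg])
    fix a b assume "[a = b] (mod int q)"
    hence "[a ^ j = b ^ j] (mod int q)" by (rule cong_pow)
    thus "a ^ j mod int q = b ^ j mod int q" by (simp add: cong_def)
  qed
  hence "(\<Sum>a\<in>Zq. (int g * a) ^ j) mod int q = (\<Sum>a\<in>Zq. a ^ j) mod int q"
    by (metis mod_sum_eq)
  hence "int q dvd (\<Sum>a\<in>Zq. (int g * a) ^ j) - (\<Sum>a\<in>Zq. a ^ j)"
    by (simp add: mod_eq_dvd_iff)
  also have "(\<Sum>a\<in>Zq. (int g * a) ^ j) - (\<Sum>a\<in>Zq. a ^ j) = (int g ^ j - 1) * (\<Sum>a\<in>Zq. a ^ j)"
    by (simp add: power_mult_distrib sum_distrib_left[symmetric] left_diff_distrib)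
  finally show ?thesis using gj prime_int_q prime_dvd_mult_iff by blast
qed

text \<open>Under \<omega> -> w the value \<chi>(a) becomes a^n, so this is the vanishing of J
  modulo the prime selected by \<open>w\<close>. All exponents in the expansion lie from n to 2n,
  strictly between 0 and q-1 = 3n.\<close>

lemma jacobi_sum_mod_q: "int q dvd (\<Sum>a\<in>Zq. a ^ n * (1 - a) ^ n)"
proof -
  have "(1 - a) ^ n = (\<Sum>k\<le>n. of_nat (n choose k) * ((- 1) ^ k * a ^ k))" for a :: int
    using binomial_ring[of "- a" 1 n] by (simp add: power_minus[of a])
  hence "(\<Sum>a\<in>Zq. a ^ n * (1 - a) ^ n) =
      (\<Sum>a\<in>Zq. \<Sum>k\<le>n. (of_nat (n choose k) * (- 1) ^ k) * a ^ (n + k))"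
    by (simp only: sum_distrib_left power_add mult_ac)
  also have "\<dots> = (\<Sum>k\<le>n. of_nat (n choose k) * (- 1) ^ k * (\<Sum>a\<in>Zq. a ^ (n + k)))"
    by (subst sum.swap) (simp add: sum_distrib_left)
  also have "int q dvd \<dots>"
  proof (rule dvd_sum, rule dvd_mult, rule power_sum_Zq)
    fix k assume "k \<in> {..n}"
    thus "n + k < q - 1" "0 < n + k" using n_pos q_eq by auto
  qed
  finally show ?thesis .
qed

text \<open>\<open>A + B * w\<close> is the image of J under \<omega> -> w. The image is tracked
  term by term alongside the coordinates, which avoids setting up the ring homomorphism.\<close>

lemma J_coordinates:
  obtains A B :: int where "J = of_int A + of_int B * \<omega>" "int q dvd A + B * w"
proof -
  have *: "\<exists>A B. \<omega> ^ i = of_int A + of_int B * \<omega> \<and> [A + B * w = w ^ i] (mod int q)" for i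
  proof -
    have "i mod 3 = 0 \<or> i mod 3 = 1 \<or> i mod 3 = 2" by linarith
    moreover have "\<omega>\<^sup>2 = - 1 - \<omega>" using omega_poly by (simp add: algebra_simps eq_neg_iff_add_eq_0)
    moreover have "[- 1 - w = w\<^sup>2] (mod int q)"
    proof -
      have "- 1 - w - w\<^sup>2 = - (w\<^sup>2 + w + 1)" by simp
      thus ?thesis using w unfolding cong_iff_dvd_diff by (metis dvd_minus_iff)
    qed
    ultimately have "\<exists>A B. \<omega> ^ (i mod 3) = of_int A + of_int B * \<omega> \<and> [A + B * w = w ^ (i mod 3)] (mod int q)"
    proof (elim disjE)
      assume "i mod 3 = 0"
      thus ?thesis by (intro exI[of _ 1] exI[of _ 0]) simp
    next
      assume "i mod 3 = 1"
      thus ?thesis by (intro exI[of _ 0] exI[of _ 1]) simp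
    next
      assume "i mod 3 = 2" "\<omega>\<^sup>2 = - 1 - \<omega>" "[- 1 - w = w\<^sup>2] (mod int q)"
      thus ?thesis by (intro exI[of _ "- 1"] exI[of _ "- 1"]) simp
    qed
    thus ?thesis using omega_power_mod[of i] w_power_mod[of i] cong_sym cong_trans by metis
  qed
  have "\<exists>A B. \<chi> a * \<chi> (1 - a) = of_int A + of_int B * \<omega> \<and>
      [A + B * w = a ^ n * (1 - a) ^ n] (mod int q)" for a
  proof (cases "int q dvd a * (1 - a)")
    case True
    hence "int q dvd a ^ n * (1 - a) ^ n"
      using n_pos by (metis dvd_power dvd_trans power_mult_distrib)
    moreover have "\<chi> a * \<chi> (1 - a) = 0" using True chi_0 chi_mult by metis
    ultimately show ?thesis
      by (intro exI[of _ 0]) (simp add: cong_0_iff cong_sym_eq[of 0])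
  next
    case False
    then obtain i where "[(a * (1 - a)) ^ n = w ^ i] (mod int q)" "\<chi> (a * (1 - a)) = \<omega> ^ i"
      by (rule chi_E)
    thus ?thesis using *[of i] unfolding chi_mult power_mult_distrib by (metis cong_sym cong_trans)
  qed
  then obtain A B where AB: "\<And>a. \<chi> a * \<chi> (1 - a) = of_int (A a) + of_int (B a) * \<omega>"
    "\<And>a. [A a + B a * w = a ^ n * (1 - a) ^ n] (mod int q)"
    by metis
  show ?thesis
  proof (rule that)
    show "J = of_int (\<Sum>a\<in>Zq. A a) + of_int (\<Sum>a\<in>Zq. B a) * \<omega>"
      unfolding J_def AB(1) by (simp add: sum.distrib sum_distrib_right)
    have "[(\<Sum>a\<in>Zq. A a + B a * w) = (\<Sum>a\<in>Zq. a ^ n * (1 - a) ^ n)] (mod int q)"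
      by (intro cong_sum AB(2))
    hence "int q dvd (\<Sum>a\<in>Zq. A a + B a * w)"
      using jacobi_sum_mod_q cong_dvd_iff by blast
    thus "int q dvd (\<Sum>a\<in>Zq. A a) + (\<Sum>a\<in>Zq. B a) * w"
      by (simp add: sum.distrib sum_distrib_right)
  qed
qed

end

subsection \<open>The action of Frobenius\<close>

text \<open>The choice N = 3q puts \<omega> and all q-th roots of unity in \<open>R\<close>. The
  locale serves two primes: p = 3, to normalize J, and the p of the theorem.\<close>

locale cubic_localization =
  cubic_character q w + cyclotomic_localization p N for q :: nat and w :: int and p N :: nat +
  assumes N_eq: "N = 3 * q"
begin

lemma R_omega: "\<omega> \<in> R"
proof -
  have "\<omega> = cis (2 * pi / real N) ^ q"
    using q_pos unfolding DeMoivre \<omega>_def N_eq by simp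
  also have "\<dots> \<in> R" by (rule R_root_power)
  finally show ?thesis .
qed

lemma R_zeta: "\<zeta> a \<in> R"
proof -
  have "\<zeta> a = \<zeta> (a mod int q)" by (rule zeta_cong) (simp add: cong_def)
  also have "\<dots> = cis (2 * pi / real N) ^ (3 * nat (a mod int q))"
    using q_pos unfolding DeMoivre \<zeta>_def N_eq by (simp add: field_simps)
  also have "\<dots> \<in> R" by (rule R_root_power)
  finally show ?thesis .
qed

lemma R_chi: "\<chi> a \<in> R"
proof (cases "int q dvd a")
  case False
  then obtain i where "\<chi> a = \<omega> ^ i" by (rule chi_E)
  thus ?thesis using R_power[OF R_omega] by simp
qed (simp add: chi_0)

lemma R_G: "G \<in> R" unfolding G_def using R_chi R_zeta by auto
lemma R_J: "J \<in> R" unfolding J_def using R_chi by auto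
lemma R_cnj_G: "cnj G \<in> R" unfolding cnj_G cnj_chi using R_chi R_zeta by auto
lemma R_cnj_J: "cnj J \<in> R"
proof -
  have "cnj J = (\<Sum>a\<in>Zq. \<chi> a ^ 2 * \<chi> (1 - a) ^ 2)"
    unfolding J_def by (simp add: cnj_chi)
  thus ?thesis using R_chi by auto
qed

lemma G_frobenius: "G ^ p \<approx> (\<Sum>a\<in>Zq. \<chi> a ^ p * \<zeta> (int p * a))"
  using frobenius_sum[of Zq "\<lambda>a. \<chi> a * \<zeta> a"] R_chi R_zeta
  unfolding G_def[symmetric] by (simp add: power_mult_distrib zeta_power R_mult)

lemma chi_power_mod: "k > 0 \<Longrightarrow> j > 0 \<Longrightarrow> k mod 3 = j mod 3 \<Longrightarrow> \<chi> a ^ k = \<chi> a ^ j"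
proof (cases "int q dvd a")
  case False
  assume "k mod 3 = j mod 3"
  moreover have "\<chi> a ^ i = \<chi> a ^ (i mod 3)" for i
  proof -
    have "\<chi> a ^ i = \<chi> a ^ (3 * (i div 3) + i mod 3)" by simp
    thus ?thesis by (simp only: power_add power_mult chi_cube[OF False] power_one mult_1_left)
  qed
  ultimately show ?thesis by metis
qed (simp add: chi_0 zero_power)

lemma sum_zeta_scaled:
  fixes f :: "complex \<Rightarrow> complex"
  assumes "\<not> int q dvd c"
  shows "(\<Sum>a\<in>Zq. f (\<chi> (c * a)) * \<zeta> (c * a)) = (\<Sum>a\<in>Zq. f (\<chi> a) * \<zeta> a)"
proof (rule sum_Zq_mult[OF _ assms])
  fix a b assume "[a = b] (mod int q)"
  thus "f (\<chi> a) * \<zeta> a = f (\<chi> b) * \<zeta> b" using chi_cong zeta_cong by metis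
qed

text \<open>Frobenius at 3 turns G^3 = qJ into the sum of \<zeta>(3a) over nonzero a, because
  \<chi>^3 is trivial there. That sum is -1, and q is 1 modulo 3.\<close>

lemma J_cong_3:
  assumes "p = 3"
  shows "J \<approx> - 1"
proof -
  have "\<not> int q dvd 3" by (rule not_q_dvd_3)
  have "G ^ 3 \<approx> (\<Sum>a\<in>Zq. \<chi> a ^ 3 * \<zeta> (3 * a))"
    using G_frobenius assms by simp
  also have "(\<Sum>a\<in>Zq. \<chi> a ^ 3 * \<zeta> (3 * a)) = (\<Sum>a\<in>Zq. \<zeta> (a * 3) - (if a = 0 then 1 else 0))"
  proof (rule sum.cong)
    fix a assume "a \<in> Zq"
    hence "int q dvd a \<longleftrightarrow> a = 0" unfolding Zq_def using zdvd_not_zless[of a "int q"] by force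
    thus "\<chi> a ^ 3 * \<zeta> (3 * a) = \<zeta> (a * 3) - (if a = 0 then 1 else 0)"
      using chi_cube[of a] chi_0[of a] by (auto simp: zeta_0 mult.commute)
  qed simp
  also have "\<dots> = - 1"
    unfolding sum_subtractf sum_zeta using \<open>\<not> int q dvd 3\<close> q_pos by (simp add: Zq_def)
  finally have "of_nat q * J \<approx> - 1" unfolding G_cube .
  moreover have "of_nat q * J \<approx> 1 * J"
  proof (rule cg_mult_right[OF _ R_J])
    have "int q - 1 = 3 * int n" using q_eq by simp
    hence "int p dvd int q - 1" using assms by simp
    thus "of_nat q \<approx> 1" using cg_int_iff[of "int q" 1] by simp
  qed
  ultimately have "1 * J \<approx> - 1" by (blast intro: cg_sym cg_trans)
  thus ?thesis by simp
qed

text \<open>Congruence modulo 3 does not allow cancelling \<open>\<omega> - 1\<close>; squaring \<open>B (\<omega> - 1) / 3\<close> and using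
  \<open>(\<omega> - 1)\<^sup>2 = -3\<omega>\<close> recovers divisibility of \<open>B\<close>.\<close>

lemma J_coordinates_3:
  fixes A B :: int
  assumes J: "J = of_int A + of_int B * \<omega>" and p3: "p = 3"
  shows "3 dvd B" "3 dvd A + 1"
proof -
  have c3: "of_int x \<approx> of_int 0 \<longleftrightarrow> 3 dvd x" for x
    unfolding cg_int_iff by (simp add: p3)
  have p_eq: "of_nat p = (3 :: complex)" by (simp add: p3)
  have sq: "(\<omega> - 1)\<^sup>2 = - 3 * \<omega>" using omega_poly by Groebner_Basis.algebra
  have w3: "\<omega> * \<omega>\<^sup>2 = 1" using omega_power_3 by (simp add: power2_eq_square power3_eq_cube mult.assoc)
  have J1: "of_int A + of_int B * \<omega> \<approx> - 1" using J_cong_3[OF p3] J by simp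
  \<comment> \<open>Multiplying J + 1 by its conjugate gives its norm, an integer, which modulo 3 is
    the square of A + 1 + B.\<close>
  have "(of_int A + of_int B * \<omega> - (- 1)) * (of_int (A + 1 - B) - of_int B * \<omega>) =
      of_int ((A + 1) * (A + 1 - B) + B\<^sup>2)"
    using omega_poly by (simp add: algebra_simps power2_eq_square) Groebner_Basis.algebra
  hence "of_int ((A + 1) * (A + 1 - B) + B\<^sup>2) \<approx> of_int 0"
    using cg_mult_right[OF cg_diff[OF J1 cg_refl[of "- 1"]] R_diff[OF R_of_int R_mult[OF R_of_int R_omega]],
        of "A + 1 - B" B]
    by simp
  hence "3 dvd (A + 1) * (A + 1 - B) + B\<^sup>2" unfolding c3 .
  hence "3 dvd (A + 1 + B)\<^sup>2 - 3 * ((A + 1) * B)"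
    by (simp add: algebra_simps power2_eq_square)
  hence "3 dvd (A + 1 + B)\<^sup>2" by (simp add: dvd_diff_left_iff)
  hence AB: "3 dvd A + 1 + B" using prime_dvd_power[of "3 :: int"] by simp
  hence "of_int (A + 1 + B) \<approx> of_int 0" unfolding c3 .
  from cg_diff[OF J1 this] have "of_int B * (\<omega> - 1) - 1 \<approx> - 1" by (simp add: algebra_simps)
  from cg_add[OF this cg_refl[of 1]] have "of_int B * (\<omega> - 1) \<approx> 0" by simp
  hence "(of_int B * (\<omega> - 1) / 3) ^ 2 * \<omega>\<^sup>2 \<in> R"
    unfolding cg_def p_eq using R_omega by (simp add: R_mult R_power)
  also have "(of_int B * (\<omega> - 1) / 3) ^ 2 * \<omega>\<^sup>2 = - (of_int (B\<^sup>2)) / 3"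
    unfolding power_divide power_mult_distrib sq using w3 by (simp add: algebra_simps)
  finally have "of_int (- B\<^sup>2) \<approx> of_int 0" unfolding cg_def p_eq by simp
  hence "3 dvd B\<^sup>2" unfolding c3 by simp
  thus B: "3 dvd B" using prime_dvd_power[of "3 :: int"] by simp
  thus "3 dvd A + 1" using AB by (simp add: dvd_add_left_iff)
qed

end

section \<open>Identification of the Jacobi sum with L and M\<close>

context cubic_character
begin

text \<open>A statement about q alone, obtained from an auxiliary instance of the localization at
  the prime 3.\<close>

lemma J_primary:
  fixes A B :: int
  assumes "J = of_int A + of_int B * \<omega>"
  shows "3 dvd B" "3 dvd A + 1"
proof -
  interpret cubic_localization q w 3 "3 * q"
    by unfold_locales (use q_pos in auto)
  show "3 dvd B" "3 dvd A + 1" using J_coordinates_3[OF assms] by auto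
qed

text \<open>Two representations \<open>(L, M)\<close> and \<open>(L', M')\<close> of \<open>4q\<close> satisfy
  \<open>(LL' + 27MM')\<^sup>2 + 27(LM' - L'M)\<^sup>2 = 16q\<^sup>2\<close>. As \<open>q\<close> divides \<open>LM' - L'M\<close>, this difference vanishes.\<close>

lemma J_eq:
  fixes L M :: int
  assumes LM: "4 * int q = L\<^sup>2 + 27 * M\<^sup>2" and L: "[L = 1] (mod 3)"
    and wLM: "int q dvd L + 3 * M * (2 * w + 1)"
  shows "J = (of_int L + 3 * of_int M * (2 * \<omega> + 1)) / 2"
proof -
  obtain A B where J: "J = of_int A + of_int B * \<omega>" and AB: "int q dvd A + B * w"
    by (rule J_coordinates)
  obtain M' where B: "B = 3 * M'" using J_primary(1)[OF J] by blast
  \<comment> \<open>Then J = (L' + 3M'(2\<omega> + 1))/2, so (L', M') is a second representation of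
    4q.\<close>
  define L' where "L' = 2 * A - B"
  have L': "[L' = 1] (mod 3)"
  proof -
    have "L' - 1 = 2 * (A + 1) - 3 * (M' + 1)" unfolding L'_def B by simp
    moreover have "3 dvd 2 * (A + 1) - 3 * (M' + 1)"
      by (rule dvd_diff[OF dvd_mult[OF J_primary(2)[OF J]] dvd_triv_left])
    ultimately show ?thesis unfolding cong_iff_dvd_diff by simp
  qed
  have "J * cnj J = of_int (A\<^sup>2 - A * B + B\<^sup>2)"
    unfolding J using omega_poly by (simp add: cnj_omega) Groebner_Basis.algebra
  hence "of_int (A\<^sup>2 - A * B + B\<^sup>2) = (of_int (int q) :: complex)" using J_norm by simp
  hence "A\<^sup>2 - A * B + B\<^sup>2 = int q" unfolding of_int_eq_iff .
  hence LM': "L'\<^sup>2 + 27 * M'\<^sup>2 = 4 * int q"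
    unfolding L'_def B by (simp add: algebra_simps power2_eq_square)
  define K where "K = L * M' - L' * M"
  have "int q dvd K"
  proof -
    have "K = (L + 3 * M * (2 * w + 1)) * M' - (A + B * w) * (2 * M)"
      unfolding K_def L'_def B by (simp add: algebra_simps)
    thus ?thesis using wLM AB by (simp add: dvd_diff)
  qed
  then obtain k where k: "K = int q * k" by blast
  have "(L * L' + 27 * M * M')\<^sup>2 + 27 * K\<^sup>2 = (L\<^sup>2 + 27 * M\<^sup>2) * (L'\<^sup>2 + 27 * M'\<^sup>2)"
    unfolding K_def by (simp add: algebra_simps power2_eq_square)
  also have "\<dots> = 16 * (int q)\<^sup>2" unfolding LM' LM[symmetric] by (simp add: power2_eq_square)
  finally have "27 * K\<^sup>2 \<le> 16 * (int q)\<^sup>2" using zero_le_power2[of "L * L' + 27 * M * M'"] by linarith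
  \<comment> \<open>A nonzero multiple of q is too large: 27 exceeds 16.\<close>
  hence "(int q)\<^sup>2 * (27 * k\<^sup>2) \<le> (int q)\<^sup>2 * 16" unfolding k by (simp add: power_mult_distrib)
  hence "27 * k\<^sup>2 \<le> 16" using q_pos by (simp add: mult_le_cancel_left)
  hence "k\<^sup>2 \<le> 0" by linarith
  hence "K = 0" using k by simp
  hence e: "L * M' = L' * M" unfolding K_def by simp
  have "L\<^sup>2 * (4 * int q) = L\<^sup>2 * L'\<^sup>2 + 27 * (L * M')\<^sup>2"
    unfolding LM'[symmetric] by (simp add: algebra_simps power2_eq_square)
  also have "\<dots> = L'\<^sup>2 * (4 * int q)"
    unfolding e LM by (simp add: algebra_simps power2_eq_square)
  finally have "L\<^sup>2 = L'\<^sup>2" using q_pos by simp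
  hence "L = L' \<or> L = - L'" by (simp add: power2_eq_iff)
  hence LL: "L = L'"
  proof
    assume "L = - L'"
    hence "[- L' = L'] (mod 3)" using L L' cong_sym cong_trans by blast
    hence "3 dvd 2 * L'" unfolding cong_iff_dvd_diff by (metis dvd_minus_iff minus_add_distrib mult_2 diff_conv_add_uminus)
    hence "3 dvd L'" by presburger
    hence "[1 = 0] (mod (3 :: int))" using L' by (metis cong_0_iff cong_sym cong_trans)
    thus ?thesis by (simp add: cong_def)
  qed
  have "L \<noteq> 0" using L by (auto simp: cong_def)
  hence MM: "M = M'" using e unfolding LL by simp
  show ?thesis unfolding J LL MM L'_def B by (simp add: field_simps)
qed

end

context cubic_localization
begin

lemma cg_inverse:
  assumes "x \<approx> y" "x * x' = 1" "y * y' = 1" "x' \<in> R" "y' \<in> R"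
  shows "x' \<approx> y'"
proof -
  have "x' * y' * y \<approx> x' * y' * x" using assms by (intro cg_mult_left cg_sym[OF assms(1)]) auto
  moreover have "x' * y' * y = x'" "x' * y' * x = y'" using assms(2,3) by (simp_all add: mult_ac)
  ultimately show ?thesis by simp
qed

text \<open>Frobenius fixes integers modulo p and sends \<omega> to \<omega> or its conjugate
  according to p modulo 3.\<close>

lemma J_frobenius:
  "p mod 3 = 1 \<Longrightarrow> cnj J ^ p \<approx> cnj J" "p mod 3 = 2 \<Longrightarrow> cnj J ^ p \<approx> J"
proof -
  obtain A B :: int where J: "J = of_int A + of_int B * \<omega>" by (rule J_coordinates)
  have cJ: "cnj J = of_int A + of_int B * \<omega>\<^sup>2" unfolding J by (simp add: cnj_omega)
  have "cnj J ^ p \<approx> of_int A ^ p + (of_int B * \<omega>\<^sup>2) ^ p"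
    unfolding cJ using R_omega by (intro frobenius_add) auto
  also have "(of_int B * \<omega>\<^sup>2) ^ p = of_int B ^ p * (\<omega> ^ p)\<^sup>2"
    by (simp add: power_mult_distrib power_mult[symmetric] mult.commute)
  also have "of_int A ^ p + of_int B ^ p * (\<omega> ^ p)\<^sup>2 \<approx> of_int A + of_int B * (\<omega> ^ p)\<^sup>2"
    using R_omega by (intro cg_add cg_mult_right frobenius_int) auto
  finally have *: "cnj J ^ p \<approx> of_int A + of_int B * (\<omega> ^ p)\<^sup>2" .
  show "cnj J ^ p \<approx> cnj J" if "p mod 3 = 1"
    using * omega_power_mod[of p] that unfolding cJ by simp
  have "(\<omega>\<^sup>2)\<^sup>2 = \<omega>" using omega_poly by Groebner_Basis.algebra
  thus "cnj J ^ p \<approx> J" if "p mod 3 = 2"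
    using * omega_power_mod[of p] that unfolding J by simp
qed

end

section \<open>Frobenius on the Gauss sum and on the roots\<close>

locale cubic_frobenius = cubic_localization +
  assumes pq: "p \<noteq> q" and p2: "p \<noteq> 2" and p3: "p \<noteq> 3"
begin

lemma not_q_dvd_p: "\<not> int q dvd int p"
  using p q pq primes_dvd_imp_eq by auto

lemma not_p_dvd_q: "\<not> int p dvd int q"
  using p q pq primes_dvd_imp_eq by auto

lemma not_p_dvd_3: "\<not> int p dvd 3"
proof
  assume "int p dvd 3"
  hence "p dvd 3" using int_dvd_int_iff[of p 3] by simp
  moreover have "prime (3 :: nat)" by simp
  ultimately show False using p p3 primes_dvd_imp_eq by blast
qed

lemma p_mod_6: "p mod 6 = 1 \<or> p mod 6 = 5"
proof -
  have "\<not> 2 dvd p" using p p2 by (metis primes_dvd_imp_eq two_is_prime_nat)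
  moreover have "prime (3 :: nat)" by simp
  hence "\<not> 3 dvd p" using p p3 primes_dvd_imp_eq by blast
  ultimately show ?thesis by presburger
qed

text \<open>In the sum of \<chi>(a)^p \<zeta>(pa) the power \<chi>^p is \<chi> or its conjugate;
  passing from a to pa costs the inverse of that character's value at p.\<close>

lemma G_power_p:
  "p mod 3 = 1 \<Longrightarrow> G ^ p \<approx> \<chi> (int p) ^ 2 * G" "p mod 3 = 2 \<Longrightarrow> G ^ p \<approx> \<chi> (int p) * cnj G"
proof -
  have cube: "\<chi> (int p) ^ 3 = 1" by (rule chi_cube[OF not_q_dvd_p])
  have p0: "p > 0" using p prime_gt_0_nat by blast
  show "G ^ p \<approx> \<chi> (int p) ^ 2 * G" if "p mod 3 = 1"
  proof -
    have "(\<Sum>a\<in>Zq. \<chi> a ^ p * \<zeta> (int p * a)) = (\<Sum>a\<in>Zq. \<chi> (int p) ^ 2 * (\<chi> (int p * a) * \<zeta> (int p * a)))"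
    proof (rule sum.cong)
      fix a
      have "\<chi> a ^ p = \<chi> a" using chi_power_mod[of p 1 a] that p0 by simp
      also have "\<dots> = \<chi> (int p) ^ 3 * \<chi> a" using cube by simp
      finally show "\<chi> a ^ p * \<zeta> (int p * a) = \<chi> (int p) ^ 2 * (\<chi> (int p * a) * \<zeta> (int p * a))"
        by (simp add: chi_mult power2_eq_square power3_eq_cube)
    qed simp
    also have "\<dots> = \<chi> (int p) ^ 2 * G"
      unfolding sum_distrib_left[symmetric] sum_zeta_scaled[OF not_q_dvd_p, of "\<lambda>x. x"] G_def ..
    finally show ?thesis using G_frobenius by simp
  qed
  show "G ^ p \<approx> \<chi> (int p) * cnj G" if "p mod 3 = 2"
  proof -
    have "(\<Sum>a\<in>Zq. \<chi> a ^ p * \<zeta> (int p * a)) = (\<Sum>a\<in>Zq. \<chi> (int p) * (cnj (\<chi> (int p * a)) * \<zeta> (int p * a)))"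
    proof (rule sum.cong)
      fix a
      have "\<chi> a ^ p = \<chi> a ^ 2" using chi_power_mod[of p 2 a] that p0 by simp
      also have "\<dots> = \<chi> (int p) ^ 3 * \<chi> a ^ 2" using cube by simp
      finally show "\<chi> a ^ p * \<zeta> (int p * a) = \<chi> (int p) * (cnj (\<chi> (int p * a)) * \<zeta> (int p * a))"
        unfolding cnj_chi by (simp add: chi_mult power2_eq_square power3_eq_cube)
    qed simp
    also have "\<dots> = \<chi> (int p) * cnj G"
      unfolding sum_distrib_left[symmetric] sum_zeta_scaled[OF not_q_dvd_p, of cnj] cnj_G ..
    finally show ?thesis using G_frobenius by simp
  qed
qed

lemma G_nonzero: "G \<noteq> 0" using G_mult_cnj q_pos by auto
lemma J_nonzero: "J \<noteq> 0" using J_norm q_pos by auto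

definition \<alpha> :: complex where "\<alpha> = \<chi> (int p) ^ 2"

lemma alpha_cube: "\<alpha> ^ 3 = 1"
  unfolding \<alpha>_def using chi_cube[OF not_q_dvd_p] by (metis mult.commute power_mult power_one)

lemma R_alpha: "\<alpha> \<in> R" unfolding \<alpha>_def using R_chi by auto

context
  fixes \<delta> z :: complex
  assumes \<delta>: "\<delta> ^ 6 = 1" "\<delta> \<in> R" and z: "z = \<delta> * G / J"
begin

text \<open>Norms rewrite z and 1/z with q as the only denominator, which puts both in
  \<open>R\<close>. Letting \<delta> be any sixth root of unity covers the sign of z and all three
  cube roots at once.\<close>

lemma unit_eq:
  "z = \<delta> * G * cnj J * inverse (of_int (int q))" "1 / z = \<delta> ^ 5 * cnj G * J * inverse (of_int (int q))"
proof -
  have q0: "of_nat q \<noteq> (0 :: complex)" using q_pos by simp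
  have \<delta>0: "\<delta> \<noteq> 0" using \<delta> by auto
  show "z = \<delta> * G * cnj J * inverse (of_int (int q))"
    unfolding z using J_norm J_nonzero q0 by (simp add: field_simps)
  have \<delta>5: "1 / \<delta> = \<delta> ^ 5"
    using \<delta>(1) \<delta>0 by (simp add: divide_eq_eq power_Suc2[symmetric])
  have JG: "J / G = cnj G * J * inverse (of_int (int q))"
    using G_mult_cnj G_nonzero q0 by (simp add: field_simps)
  have "1 / z = 1 / \<delta> * (J / G)" unfolding z by simp
  thus "1 / z = \<delta> ^ 5 * cnj G * J * inverse (of_int (int q))"
    unfolding \<delta>5 JG by (simp only: mult.assoc)
qed

lemma unit_R: "z \<in> R" "1 / z \<in> R" "z \<noteq> 0"
proof -
  have iR: "inverse (of_int (int q)) \<in> R" by (rule R_inverse_int[OF not_p_dvd_q])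
  show "z \<in> R" unfolding unit_eq(1) using \<delta> R_G R_cnj_J iR by (intro R_mult)
  show "1 / z \<in> R" unfolding unit_eq(2) using \<delta> R_J R_cnj_G iR by (intro R_mult R_power)
  show "z \<noteq> 0" unfolding z using \<delta> G_nonzero J_nonzero by auto
qed

text \<open>For p = 1 modulo 3, z^p is \<alpha>z; for p = 2 it is the inverse of \<alpha>z. The sum
  with the inverse is the same in both cases. The residue modulo 6 is used because \<delta>^6 =
  1.\<close>

lemma unit_power_p: "z ^ p + (1 / z) ^ p \<approx> \<alpha> * z + 1 / (\<alpha> * z)"
proof -
  note zR = unit_R and zq = unit_eq(1) and iz = unit_eq(2)
  have \<alpha>0: "\<alpha> \<noteq> 0" using alpha_cube by auto
  have ia: "1 / \<alpha> = \<chi> (int p)"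
  proof -
    have "\<chi> (int p) * \<alpha> = 1" unfolding \<alpha>_def using chi_cube[OF not_q_dvd_p]
      by (simp add: power2_eq_square power3_eq_cube mult.assoc)
    thus ?thesis using \<alpha>0 by (simp add: field_simps)
  qed
  have azR: "1 / (\<alpha> * z) \<in> R"
    using R_mult[OF R_chi zR(2), of "int p"] unfolding ia[symmetric] by simp
  have \<delta>p: "\<delta> ^ p = \<delta> ^ (p mod 6)"
  proof -
    have "\<delta> ^ p = \<delta> ^ (6 * (p div 6) + p mod 6)" by simp
    thus ?thesis by (simp only: power_add power_mult \<delta>(1) power_one mult_1_left)
  qed
  have iR: "inverse (of_int (int q)) \<in> R" by (rule R_inverse_int[OF not_p_dvd_q])
  have zp: "z ^ p = \<delta> ^ p * (G ^ p * (cnj J ^ p * inverse (of_int (int q)) ^ p))"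
    unfolding zq power_mult_distrib by (simp add: mult_ac)
  from p_mod_6 show ?thesis
  proof
    assume p6: "p mod 6 = 1"
    hence p3: "p mod 3 = 1" by presburger
    have "z ^ p \<approx> \<delta> ^ p * ((\<chi> (int p) ^ 2 * G) * (cnj J * inverse (of_int (int q))))"
      unfolding zp using \<delta>(2) R_chi R_G R_cnj_J iR
      by (intro cg_mult_left cg_mult G_power_p J_frobenius frobenius_inverse_int not_p_dvd_q p3) auto
    also have "\<dots> = \<alpha> * z" unfolding \<delta>p p6 \<alpha>_def zq by (simp add: mult_ac)
    finally have 1: "z ^ p \<approx> \<alpha> * z" .
    have "(1 / z) ^ p \<approx> 1 / (\<alpha> * z)"
      by (rule cg_inverse[OF 1 _ _ R_power[OF zR(2)] azR]) (use zR \<alpha>0 in \<open>auto simp: power_one_over\<close>)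
    with 1 show ?thesis by (rule cg_add)
  next
    assume p6: "p mod 6 = 5"
    hence p3: "p mod 3 = 2" by presburger
    have "z ^ p \<approx> \<delta> ^ p * ((\<chi> (int p) * cnj G) * (J * inverse (of_int (int q))))"
      unfolding zp using \<delta>(2) R_chi R_cnj_G R_cnj_J R_J iR
      by (intro cg_mult_left cg_mult G_power_p J_frobenius frobenius_inverse_int not_p_dvd_q p3) auto
    also have "\<dots> = \<chi> (int p) * (1 / z)" unfolding \<delta>p p6 iz by (simp add: mult_ac)
    also have "\<dots> = 1 / (\<alpha> * z)" unfolding ia[symmetric] by simp
    finally have 1: "z ^ p \<approx> 1 / (\<alpha> * z)" .
    have "(1 / z) ^ p \<approx> \<alpha> * z"
      by (rule cg_inverse[OF 1 _ _ R_power[OF zR(2)] R_mult[OF R_alpha zR(1)]])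
        (use zR \<alpha>0 in \<open>auto simp: power_one_over\<close>)
    from cg_add[OF 1 this] show ?thesis by (simp add: add.commute)
  qed
qed

lemma cubic_root_param_frobenius:
  "cubic_root_param z \<in> R" "cubic_root_param (\<alpha> * z) \<in> R"
    "cubic_root_param z ^ p \<approx> cubic_root_param (\<alpha> * z)"
proof -
  note zR = unit_R
  have t: "cubic_root_param y = (1 + y + 1 / y) * inverse (of_int 3)" for y :: complex
    unfolding cubic_root_param_def by (simp add: field_simps)
  have i3: "inverse (of_int 3) \<in> R" by (rule R_inverse_int[OF not_p_dvd_3])
  show tR: "cubic_root_param z \<in> R" unfolding t using zR i3 by (intro R_mult R_add R_1)
  have "cubic_root_param z ^ p = (1 + z + 1 / z) ^ p * inverse (of_int 3) ^ p"
    unfolding t power_mult_distrib ..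
  also have "\<dots> \<approx> (1 + (\<alpha> * z + 1 / (\<alpha> * z))) * inverse (of_int 3)"
  proof (rule cg_mult)
    have "(1 + z + 1 / z) ^ p \<approx> (1 + z) ^ p + (1 / z) ^ p" using zR by (intro frobenius_add) auto
    also have "\<dots> \<approx> 1 ^ p + z ^ p + (1 / z) ^ p" using zR by (intro cg_add frobenius_add) auto
    also have "\<dots> = 1 + (z ^ p + (1 / z) ^ p)" by simp
    also have "\<dots> \<approx> 1 + (\<alpha> * z + 1 / (\<alpha> * z))"
      by (intro cg_add unit_power_p cg_refl)
    finally show *: "(1 + z + 1 / z) ^ p \<approx> 1 + (\<alpha> * z + 1 / (\<alpha> * z))" .
    have "(1 + z + 1 / z) ^ p \<in> R" using zR by auto
    thus "1 + (\<alpha> * z + 1 / (\<alpha> * z)) \<in> R" by (rule cg_R[OF cg_sym[OF *]])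
    show "inverse (of_int 3) ^ p \<approx> inverse (of_int 3)" by (rule frobenius_inverse_int[OF not_p_dvd_3])
    show "inverse (of_int 3) ^ p \<in> R" using i3 by auto
  qed
  also have "\<dots> = cubic_root_param (\<alpha> * z)" unfolding t by (simp add: add.assoc)
  finally show *: "cubic_root_param z ^ p \<approx> cubic_root_param (\<alpha> * z)" .
  show "cubic_root_param (\<alpha> * z) \<in> R" by (rule cg_R[OF cg_sym[OF *]]) (use tR in auto)
qed

end

section \<open>Values of both sums modulo p in terms of J and \<alpha>\<close>

context
  fixes \<epsilon> u :: complex
  assumes \<epsilon>: "\<epsilon> = 1 \<or> \<epsilon> = - 1" and u: "u = \<epsilon> * G / J"
begin

text \<open>The three arguments are \<delta>G/J for \<delta> = \<epsilon>, \<omega>\<epsilon>,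
  \<omega>^2 \<epsilon>, so the Frobenius congruence applies to each term.\<close>

lemma cube_orbit_sum_cg:
  assumes "\<And>\<delta> z. \<delta> ^ 6 = 1 \<Longrightarrow> \<delta> \<in> R \<Longrightarrow> z = \<delta> * G / J \<Longrightarrow> z ^ 3 = u ^ 3 \<Longrightarrow> f z \<approx> g z"
  shows "cube_orbit_sum \<omega> f u \<approx> cube_orbit_sum \<omega> g u"
  unfolding cube_orbit_sum_def
proof (intro cg_add assms)
  have \<epsilon>6: "\<epsilon> ^ 6 = 1" and \<epsilon>R: "\<epsilon> \<in> R" using \<epsilon> R_uminus[OF R_1] by auto
  have \<omega>6: "\<omega> ^ 6 = 1" "(\<omega>\<^sup>2) ^ 6 = 1"
    using omega_power_mod[of 6] omega_power_mod[of 12] by (simp_all add: power_mult[symmetric])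
  show "\<epsilon> ^ 6 = 1" "\<epsilon> \<in> R" "u = \<epsilon> * G / J" by fact+
  show "(\<omega> * \<epsilon>) ^ 6 = 1" "(\<omega>\<^sup>2 * \<epsilon>) ^ 6 = 1"
    unfolding power_mult_distrib \<omega>6 \<epsilon>6 by simp_all
  show "\<omega> * \<epsilon> \<in> R" "\<omega>\<^sup>2 * \<epsilon> \<in> R" using \<epsilon>R R_omega by auto
  show "\<omega> * u = \<omega> * \<epsilon> * G / J" "\<omega>\<^sup>2 * u = \<omega>\<^sup>2 * \<epsilon> * G / J" unfolding u by simp_all
  show "(\<omega> * u) ^ 3 = u ^ 3" "(\<omega>\<^sup>2 * u) ^ 3 = u ^ 3" by (rule cube_orbit[OF omega_poly])+
qed (rule refl)

lemma u_cube: "u ^ 3 = \<epsilon> * cnj J / J"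
proof -
  have "\<epsilon> ^ 3 = \<epsilon>" using \<epsilon> by auto
  hence "u ^ 3 = \<epsilon> * (of_nat q * J) / J ^ 3"
    unfolding u power_divide power_mult_distrib G_cube by simp
  also have "\<dots> = \<epsilon> * cnj J / J"
    unfolding J_norm[symmetric] using J_nonzero by (simp add: power3_eq_cube)
  finally show ?thesis .
qed

lemma u_unit: "u \<in> R" "1 / u \<in> R" "u \<noteq> 0"
  using unit_R[of \<epsilon> u] \<epsilon> u R_uminus[OF R_1] by auto

lemma trinomial_x_R: "(2 - u ^ 3 - 1 / u ^ 3) / 27 \<in> R"
proof -
  have "\<not> int p dvd 27"
    using not_p_dvd_3 prime_dvd_power[OF prime_int_p, of 3 3] by auto
  moreover have "2 - u ^ 3 - (1 / u) ^ 3 \<in> R" using u_unit by auto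
  ultimately have "(2 - u ^ 3 - (1 / u) ^ 3) / of_int 27 \<in> R" by (intro R_divide_int)
  thus ?thesis by (simp add: power_one_over)
qed

text \<open>The index 2p-1 means exponent 2p in the closed form, that is (t^p)^2. The weight is a
  fixed factor of the congruence, so it must lie in \<open>R\<close>; hence the condition on 1/(u^3
  + 1).\<close>

lemma binomial_sum_value:
  assumes unit: "1 / (u ^ 3 + 1) \<in> R" "u ^ 3 \<noteq> - 1"
  defines "x \<equiv> (2 - u ^ 3 - 1 / u ^ 3) / 27"
  shows "(\<Sum>k = 0..p - 1. of_nat ((3 * k) choose k) * x ^ k) \<approx>
    (u ^ 3 * (2 * \<alpha> + \<alpha>\<^sup>2) + (\<alpha> + 2 * \<alpha>\<^sup>2)) / (3 * (u ^ 3 + 1))"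
proof -
  have p0: "2 * p - 1 + 1 = p * 2" using prime_ge_2_nat[OF p] by simp
  have "(\<Sum>k = 0..p - 1. of_nat ((3 * k) choose k) * x ^ k) \<approx> trinomial_sum x (2 * p - 1)"
    unfolding x_def by (intro binomial_sum_cg trinomial_x_R)
  also have "\<dots> = cube_orbit_sum \<omega> (\<lambda>z. cubic_root_param z ^ (p * 2) * (z * (z + 1) / (z ^ 3 + 1))) u"
    unfolding x_def trinomial_sum_closed_form[OF omega_poly u_unit(3) unit(2)] p0 ..
  also have "\<dots> \<approx> cube_orbit_sum \<omega> (\<lambda>z. cubic_root_param (\<alpha> * z) ^ 2 * (z * (z + 1) / (z ^ 3 + 1))) u"
  proof (rule cube_orbit_sum_cg)
    fix \<delta> z assume z: "\<delta> ^ 6 = 1" "\<delta> \<in> R" "z = \<delta> * G / J" "z ^ 3 = u ^ 3"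
    note t = cubic_root_param_frobenius[OF z(1-3)]
    show "cubic_root_param z ^ (p * 2) * (z * (z + 1) / (z ^ 3 + 1)) \<approx>
        cubic_root_param (\<alpha> * z) ^ 2 * (z * (z + 1) / (z ^ 3 + 1))"
      unfolding power_mult
    proof (rule cg_mult_right)
      show "(cubic_root_param z ^ p) ^ 2 \<approx> cubic_root_param (\<alpha> * z) ^ 2" using t by (intro cg_power)
      have "z * (z + 1) * (1 / (z ^ 3 + 1)) \<in> R"
        unfolding z(4) using unit_R[OF z(1-3)] unit by (intro R_mult R_add R_1)
      thus "z * (z + 1) / (z ^ 3 + 1) \<in> R" by simp
    qed
  qed
  also have "\<dots> = (u ^ 3 * (2 * \<alpha> + \<alpha>\<^sup>2) + (\<alpha> + 2 * \<alpha>\<^sup>2)) / (3 * (u ^ 3 + 1))"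
    by (rule cube_orbit_sum_shift_binomial[OF omega_poly u_unit(3) unit(2) alpha_cube])
  finally show ?thesis .
qed

text \<open>The exponent 2p-1 is raised to 2p by inserting t times \<open>h\<close>, where
  \<open>h\<close> is 1/t; its denominator requires the condition on 1/(u^3 - 1).\<close>

lemma catalan2_sum_value:
  assumes unit: "1 / (u ^ 3 - 1) \<in> R" "u ^ 3 \<noteq> 1" "u ^ 3 \<noteq> - 1"
  defines "x \<equiv> (2 - u ^ 3 - 1 / u ^ 3) / 27"
  shows "(\<Sum>k = 0..p - 1. of_rat (catalan2 k) * x ^ k) \<approx>
    (u ^ 3 * (2 * \<alpha> - \<alpha>\<^sup>2) + (\<alpha> - 2 * \<alpha>\<^sup>2)) / (u ^ 3 - 1)"
proof -
  have p0: "2 * p - 1 = (2 * p - 4) + 3" using prime_ge_2_nat[OF p] by simp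
  have p1: "p * 2 = Suc ((2 * p - 4) + 3)" using prime_ge_2_nat[OF p] by simp
  have "(\<Sum>k = 0..p - 1. of_rat (catalan2 k) * x ^ k) \<approx>
      trinomial_sum x (2 * p - 1) - 2 * x * trinomial_sum x (2 * p - 4)"
    unfolding x_def by (intro catalan2_sum_cg trinomial_x_R)
  also have "\<dots> = cube_orbit_sum \<omega> (\<lambda>z. cubic_root_param z ^ ((2 * p - 4) + 3)) u"
    unfolding x_def p0 by (rule trinomial_sum_closed_form_power_sum[OF omega_poly u_unit(3) unit(3)])
  also have "\<dots> \<approx> cube_orbit_sum \<omega> (\<lambda>z. cubic_root_param (\<alpha> * z) ^ 2 * (3 * z * (z - 1) / (z ^ 3 - 1))) u"
  proof (rule cube_orbit_sum_cg)
    fix \<delta> z assume z: "\<delta> ^ 6 = 1" "\<delta> \<in> R" "z = \<delta> * G / J" "z ^ 3 = u ^ 3"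
    note t = cubic_root_param_frobenius[OF z(1-3)]
    define h where "h = 3 * z * (z - 1) / (z ^ 3 - 1)"
    have "cubic_root_param z * (3 * z * (z - 1)) = z ^ 3 - 1"
      using unit_R(3)[OF z(1-3)] unfolding cubic_root_param_def
      by (simp add: field_simps power2_eq_square power3_eq_cube)
    hence h: "cubic_root_param z * h = 1" unfolding h_def using unit(2) z(4) by simp
    have "cubic_root_param z ^ ((2 * p - 4) + 3) = cubic_root_param z ^ ((2 * p - 4) + 3) * (cubic_root_param z * h)"
      unfolding h by simp
    also have "\<dots> = (cubic_root_param z ^ p) ^ 2 * h"
      unfolding power_mult[symmetric] p1 by (simp only: power_Suc2 mult.assoc)
    also have "\<dots> \<approx> cubic_root_param (\<alpha> * z) ^ 2 * h"
    proof (rule cg_mult_right)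
      show "(cubic_root_param z ^ p) ^ 2 \<approx> cubic_root_param (\<alpha> * z) ^ 2" using t by (intro cg_power)
      have "3 * z * (z - 1) * (1 / (z ^ 3 - 1)) \<in> R"
        unfolding z(4) using unit_R[OF z(1-3)] unit by (intro R_mult R_diff R_1 R_numeral)
      thus "h \<in> R" by (simp add: h_def)
    qed
    finally show "cubic_root_param z ^ ((2 * p - 4) + 3) \<approx>
        cubic_root_param (\<alpha> * z) ^ 2 * (3 * z * (z - 1) / (z ^ 3 - 1))" unfolding h_def .
  qed
  also have "\<dots> = (u ^ 3 * (2 * \<alpha> - \<alpha>\<^sup>2) + (\<alpha> - 2 * \<alpha>\<^sup>2)) / (u ^ 3 - 1)"
    by (rule cube_orbit_sum_shift_catalan[OF omega_poly u_unit(3) unit(2) alpha_cube])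
  finally show ?thesis .
qed

end

end

context cyclotomic_localization
begin

lemma rat_cong_fractionI:
  assumes "of_rat r \<approx> of_int c / of_int d" "\<not> int p dvd d"
  shows "[r = of_int c / of_int d] (ratmod int p)"
proof -
  have "of_int c / of_int d \<in> R" using assms(2) by (intro R_divide_int R_of_int)
  thus ?thesis
    using assms(1) by (intro rat_congI) (auto simp: of_rat_divide intro: cg_R)
qed

end

subsection \<open>Evaluation of the sums\<close>

lemma rat_cong_fractionD:
  assumes q: "prime q" and cong: "[of_int a = r] (ratmod q)" and r: "r * of_int d = of_int b"
  shows "q dvd a * d - b"
proof -
  obtain x y where xy: "quotient_of (of_int a - r) = (x, y)" by force
  have y: "y > 0" "coprime x y" "of_int a - r = of_int x / of_int y"
    using quotient_of_denom_pos[OF xy] quotient_of_coprime[OF xy] quotient_of_div[OF xy] by auto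
  have qx: "q dvd x" using cong xy unfolding rat_cong_def by simp
  have "of_int (a * d - b) = (of_int a - r) * of_int d" using r by (simp add: algebra_simps)
  hence "of_int ((a * d - b) * y) = (of_int (x * d) :: rat)" using y by (simp add: field_simps)
  hence "(a * d - b) * y = x * d" unfolding of_int_eq_iff .
  hence "q dvd (a * d - b) * y" using qx by simp
  moreover have "\<not> q dvd y" using qx y(2) q by (metis coprime_common_divisor not_prime_unit)
  ultimately show ?thesis using q prime_dvd_mult_iff by blast
qed

text \<open>If q divided M it would divide L, and then q^2 would divide 4q.\<close>

lemma norm_form_not_dvd:
  fixes L M :: int
  assumes q: "prime q" and q3: "q > 3" and LM: "4 * int q = L\<^sup>2 + 27 * M\<^sup>2"
  shows "\<not> int q dvd M"
proof
  assume "int q dvd M"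
  have q': "prime (int q)" using q by simp
  from \<open>int q dvd M\<close> obtain k where k: "M = int q * k" by blast
  have "L\<^sup>2 = int q * (4 - 27 * M * k)" using LM unfolding k by (simp add: power2_eq_square algebra_simps)
  hence "int q dvd L" using q' prime_dvd_power by (metis dvd_triv_left)
  then obtain j where j: "L = int q * j" by blast
  have "int q * 4 = int q * (int q * (j\<^sup>2 + 27 * k\<^sup>2))"
    using LM unfolding k j by (simp add: power2_eq_square algebra_simps)
  hence "4 = int q * (j\<^sup>2 + 27 * k\<^sup>2)" using q3 by (simp only: mult_cancel_left) simp
  hence "int q dvd 4" by (metis dvd_triv_left)
  hence "int q dvd 2\<^sup>2" by simp
  hence "int q dvd 2" using q' prime_dvd_power by blast
  thus False using q3 zdvd_imp_le[of "int q" 2] by simp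
qed

text \<open>\<open>wLM\<close> says that L + 3M(2\<omega> + 1) vanishes modulo q under \<omega> ->
  w. It couples the sign of M to the choice of character and so makes the signs in the theorem
  correspond.\<close>

locale cubic_norm_form = cubic_frobenius +
  fixes L M :: int
  assumes LM: "4 * int q = L\<^sup>2 + 27 * M\<^sup>2" and L_mod_3: "[L = 1] (mod 3)"
    and wLM: "int q dvd L + 3 * M * (2 * w + 1)" and pLM: "\<not> int p dvd L * M"
begin

definition \<theta> :: complex where "\<theta> = 2 * \<omega> + 1"

lemma theta_square: "\<theta>\<^sup>2 = - 3" unfolding \<theta>_def using omega_poly by Groebner_Basis.algebra

lemma theta_nonzero: "\<theta> \<noteq> 0"
proof
  assume "\<theta> = 0"
  hence "\<theta>\<^sup>2 = 0" by simp
  thus False unfolding theta_square by simp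
qed

lemma theta_mult: "\<theta> * (\<theta> * x) = - 3 * x"
  unfolding mult.assoc[symmetric] power2_eq_square[symmetric] theta_square ..

lemma R_theta: "\<theta> \<in> R" unfolding \<theta>_def using R_omega by (intro R_add R_mult R_numeral R_1)

lemma not_p_dvd: "\<not> int p dvd 2" "\<not> int p dvd 3" "\<not> int p dvd L" "\<not> int p dvd M"
proof -
  show "\<not> int p dvd 2"
  proof
    assume "int p dvd 2"
    hence "p dvd 2" using int_dvd_int_iff[of p 2] by simp
    thus False using p p2 primes_dvd_imp_eq two_is_prime_nat by blast
  qed
  show "\<not> int p dvd 3" by (rule not_p_dvd_3)
  show "\<not> int p dvd L" "\<not> int p dvd M" using pLM by auto
qed

lemma J_LM: "J + cnj J = of_int L" "J - cnj J = 3 * of_int M * \<theta>"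
proof -
  have J: "J = (of_int L + 3 * of_int M * \<theta>) / 2" unfolding \<theta>_def by (rule J_eq[OF LM L_mod_3 wLM])
  have "cnj \<theta> = - \<theta>" unfolding \<theta>_def using omega_poly by (simp add: cnj_omega) Groebner_Basis.algebra
  hence "cnj J = (of_int L - 3 * of_int M * \<theta>) / 2" unfolding J by simp
  thus "J + cnj J = of_int L" "J - cnj J = 3 * of_int M * \<theta>" unfolding J by (simp_all add: field_simps)
qed

lemma LM_nonzero: "of_int L \<noteq> (0 :: complex)" "of_int M \<noteq> (0 :: complex)"
  using pLM by auto

text \<open>Up to sign these are the inverses of u^3 + 1 and u^3 - 1, in this order for \<epsilon> =
  1 and exchanged for \<epsilon> = -1. Since \<theta>^2 = -3, the second has the integer denominator
  -9M.\<close>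

lemma units:
  "J / of_int L \<in> R" "J / (3 * of_int M * \<theta>) \<in> R"
proof -
  show "J / of_int L \<in> R" using not_p_dvd by (intro R_divide_int R_J)
  have "\<not> int p dvd (- 9) * M"
    using not_p_dvd prime_dvd_power[OF prime_int_p, of 3 2] prime_int_p
    by (auto simp: prime_dvd_mult_iff)
  hence "J * \<theta> / of_int ((- 9) * M) \<in> R" using R_J R_theta by (intro R_divide_int R_mult)
  also have "J * \<theta> / of_int ((- 9) * M) = J / (3 * of_int M * \<theta>)"
    using LM_nonzero theta_nonzero by (simp add: field_simps theta_mult)
  finally show "J / (3 * of_int M * \<theta>) \<in> R" .
qed

lemma sums_cg:
  "(\<Sum>k = 0..p - 1. of_nat ((3 * k) choose k) * (of_int M ^ 2 / of_nat q) ^ k) \<approx>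
    (cnj J * (2 * \<alpha> + \<alpha>\<^sup>2) + J * (\<alpha> + 2 * \<alpha>\<^sup>2)) / (3 * of_int L)" (is ?th1)
  "(\<Sum>k = 0..p - 1. of_nat ((3 * k) choose k) * (of_int L ^ 2 / (27 * of_nat q)) ^ k) \<approx>
    (J * (\<alpha> + 2 * \<alpha>\<^sup>2) - cnj J * (2 * \<alpha> + \<alpha>\<^sup>2)) / (9 * of_int M * \<theta>)" (is ?th2)
  "(\<Sum>k = 0..p - 1. of_rat (catalan2 k) * (of_int M ^ 2 / of_nat q) ^ k) \<approx>
    - (cnj J * (2 * \<alpha> - \<alpha>\<^sup>2) + J * (\<alpha> - 2 * \<alpha>\<^sup>2)) / (3 * of_int M * \<theta>)" (is ?th3)
  "(\<Sum>k = 0..p - 1. of_rat (catalan2 k) * (of_int L ^ 2 / (27 * of_nat q)) ^ k) \<approx>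
    (cnj J * (2 * \<alpha> - \<alpha>\<^sup>2) - J * (\<alpha> - 2 * \<alpha>\<^sup>2)) / of_int L" (is ?th4)
proof -
  have J0: "J \<noteq> 0" by (rule J_nonzero)
  have J0': "cnj J \<noteq> 0" using J0 by simp
  have t0: "3 * of_int M * \<theta> \<noteq> 0" using LM_nonzero theta_nonzero by simp
  have sq: "(J - cnj J)\<^sup>2 = - 27 * of_int M ^ 2"
    unfolding J_LM power_mult_distrib theta_square by simp
  have h: "(X / J * A + B) / (k * (T / J)) = (X * A + J * B) / (k * T)"
    if "T \<noteq> 0" "k \<noteq> 0" for X A B T k :: complex
    using that J0 by (simp add: field_simps)
  {
    \<comment> \<open>Here x = -(J - cnj J)^2/(27q), and J - cnj J = 3M\<theta> makes this
      M^2/q.\<close>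
    define u where "u = 1 * G / J"
    have u3: "u ^ 3 = cnj J / J"
      using u_cube[OF _ u_def] by simp
    have x: "(2 - u ^ 3 - 1 / u ^ 3) / 27 = of_int M ^ 2 / of_nat q"
    proof -
      have "(2 - u ^ 3 - 1 / u ^ 3) / 27 = - ((J - cnj J)\<^sup>2) / (27 * (J * cnj J))"
        unfolding u3 using J0 J0' by (simp add: field_simps power2_eq_square)
      thus ?thesis unfolding sq J_norm by simp
    qed
    have e1: "u ^ 3 + 1 = of_int L / J" unfolding u3 J_LM(1)[symmetric] using J0 by (simp add: field_simps)
    have e2: "u ^ 3 - 1 = - (3 * of_int M * \<theta>) / J"
      unfolding u3 J_LM(2)[symmetric] using J0 by (simp add: field_simps)
    have n1: "u ^ 3 \<noteq> - 1" using e1 LM_nonzero J0 by auto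
    have n2: "u ^ 3 \<noteq> 1" using e2 t0 J0 by auto
    have r1: "1 / (u ^ 3 + 1) \<in> R" unfolding e1 using units(1) by simp
    have "- (J / (3 * of_int M * \<theta>)) \<in> R" using units(2) by (rule R_uminus)
    hence r2: "1 / (u ^ 3 - 1) \<in> R" unfolding e2 by simp
    have "(u ^ 3 * (2 * \<alpha> + \<alpha>\<^sup>2) + (\<alpha> + 2 * \<alpha>\<^sup>2)) / (3 * (u ^ 3 + 1)) =
        (cnj J * (2 * \<alpha> + \<alpha>\<^sup>2) + J * (\<alpha> + 2 * \<alpha>\<^sup>2)) / (3 * of_int L)"
      unfolding e1 unfolding u3 using LM_nonzero by (subst h) auto
    with binomial_sum_value[OF _ u_def r1 n1] show ?th1 unfolding x by simp
    have "(u ^ 3 * (2 * \<alpha> - \<alpha>\<^sup>2) + (\<alpha> - 2 * \<alpha>\<^sup>2)) / (u ^ 3 - 1) =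
        - (cnj J * (2 * \<alpha> - \<alpha>\<^sup>2) + J * (\<alpha> - 2 * \<alpha>\<^sup>2)) / (3 * of_int M * \<theta>)"
      using h[of "- (3 * of_int M * \<theta>)" 1] t0
      unfolding e2 unfolding u3 by (simp add: add_divide_distrib diff_divide_distrib)
    with catalan2_sum_value[OF _ u_def r2 n2 n1] show ?th3 unfolding x by simp
  }
  {
    \<comment> \<open>The sign turns the difference into a sum: x = (J + cnj J)^2/(27q) =
      L^2/(27q).\<close>
    define u where "u = (- 1) * G / J"
    have u3: "u ^ 3 = - cnj J / J"
      using u_cube[OF _ u_def] by simp
    have x: "(2 - u ^ 3 - 1 / u ^ 3) / 27 = of_int L ^ 2 / (27 * of_nat q)"
    proof -
      have "(2 - u ^ 3 - 1 / u ^ 3) / 27 = (J + cnj J)\<^sup>2 / (27 * (J * cnj J))"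
        unfolding u3 using J0 J0' by (simp add: field_simps power2_eq_square)
      thus ?thesis unfolding J_LM J_norm .
    qed
    have e1: "u ^ 3 + 1 = 3 * of_int M * \<theta> / J"
      unfolding u3 J_LM(2)[symmetric] using J0 by (simp add: field_simps)
    have e2: "u ^ 3 - 1 = - of_int L / J" unfolding u3 J_LM(1)[symmetric] using J0 by (simp add: field_simps)
    have n1: "u ^ 3 \<noteq> - 1" using e1 t0 J0 by auto
    have n2: "u ^ 3 \<noteq> 1" using e2 LM_nonzero J0 by auto
    have r1: "1 / (u ^ 3 + 1) \<in> R" unfolding e1 using units(2) by simp
    have "- (J / of_int L) \<in> R" using units(1) by (rule R_uminus)
    hence r2: "1 / (u ^ 3 - 1) \<in> R" unfolding e2 by simp
    have "(u ^ 3 * (2 * \<alpha> + \<alpha>\<^sup>2) + (\<alpha> + 2 * \<alpha>\<^sup>2)) / (3 * (u ^ 3 + 1)) =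
        (J * (\<alpha> + 2 * \<alpha>\<^sup>2) - cnj J * (2 * \<alpha> + \<alpha>\<^sup>2)) / (3 * (3 * of_int M * \<theta>))"
      unfolding e1 unfolding u3 using t0 by (subst h) auto
    also have "3 * (3 * of_int M * \<theta>) = 9 * of_int M * \<theta>" by simp
    finally show ?th2 using binomial_sum_value[OF _ u_def r1 n1] unfolding x by simp
    have "(u ^ 3 * (2 * \<alpha> - \<alpha>\<^sup>2) + (\<alpha> - 2 * \<alpha>\<^sup>2)) / (u ^ 3 - 1) =
        (cnj J * (2 * \<alpha> - \<alpha>\<^sup>2) - J * (\<alpha> - 2 * \<alpha>\<^sup>2)) / of_int L"
      unfolding e2 unfolding u3 using J0 LM_nonzero(1) by (simp add: field_simps)
    with catalan2_sum_value[OF _ u_def r2 n2 n1] show ?th4 unfolding x by simp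
  }
qed

definition S1 :: rat where
  "S1 = (\<Sum>k = 0..p - 1. of_nat ((3 * k) choose k) * (of_int M ^ (2 * k) / of_nat q ^ k))"
definition S2 :: rat where
  "S2 = (\<Sum>k = 0..p - 1. of_nat ((3 * k) choose k) * (of_int L ^ (2 * k) / (27 * of_nat q) ^ k))"
definition S3 :: rat where
  "S3 = (\<Sum>k = 0..p - 1. catalan2 k * (of_int M ^ (2 * k) / of_nat q ^ k))"
definition S4 :: rat where
  "S4 = (\<Sum>k = 0..p - 1. catalan2 k * (of_int L ^ (2 * k) / (27 * of_nat q) ^ k))"

lemma of_rat_S:
  "of_rat S1 = (\<Sum>k = 0..p - 1. of_nat ((3 * k) choose k) * (of_int M ^ 2 / of_nat q :: complex) ^ k)"
  "of_rat S2 = (\<Sum>k = 0..p - 1. of_nat ((3 * k) choose k) * (of_int L ^ 2 / (27 * of_nat q) :: complex) ^ k)"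
  "of_rat S3 = (\<Sum>k = 0..p - 1. of_rat (catalan2 k) * (of_int M ^ 2 / of_nat q :: complex) ^ k)"
  "of_rat S4 = (\<Sum>k = 0..p - 1. of_rat (catalan2 k) * (of_int L ^ 2 / (27 * of_nat q) :: complex) ^ k)"
  unfolding S1_def S2_def S3_def S4_def
  by (simp_all add: of_rat_sum of_rat_mult of_rat_divide of_rat_power power_divide power_mult)

lemma S_cong_1:
  assumes \<alpha>: "\<alpha> = 1"
  shows "[S1 = 1] (ratmod int p)" "[S2 = 1] (ratmod int p)"
    "[S3 = 1] (ratmod int p)" "[S4 = 1] (ratmod int p)"
proof -
  define T where "T = 3 * of_int M * \<theta>"
  have T: "T \<noteq> 0" unfolding T_def using LM_nonzero theta_nonzero by simp
  have "of_rat S1 \<approx> 3 * (J + cnj J) / (3 * of_int L)" "of_rat S2 \<approx> 3 * (J - cnj J) / (3 * T)"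
    "of_rat S3 \<approx> (J - cnj J) / T" "of_rat S4 \<approx> (J + cnj J) / of_int L"
    using sums_cg unfolding of_rat_S[symmetric] \<alpha> T_def by (simp_all add: algebra_simps)
  hence "of_rat S1 \<approx> 1" "of_rat S2 \<approx> 1" "of_rat S3 \<approx> 1" "of_rat S4 \<approx> 1"
    unfolding J_LM T_def[symmetric] using T LM_nonzero by simp_all
  thus "[S1 = 1] (ratmod int p)" "[S2 = 1] (ratmod int p)"
    "[S3 = 1] (ratmod int p)" "[S4 = 1] (ratmod int p)"
    using rat_cong_fractionI[of _ 1 1] prime_gt_1_nat[OF p] by simp_all
qed

text \<open>The cases t = 1 and t = -1 are \<alpha> = \<omega> and \<alpha> = \<omega>^2. The sign
  -t in the second and third value is undone by the one in \<open>alpha_eq_M_over_L\<close>.\<close>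

lemma S_cong_t:
  fixes t :: int
  assumes \<alpha>: "\<alpha> = (- 1 + of_int t * \<theta>) / 2" and t: "t = 1 \<or> t = - 1"
  shows "[S1 = of_int (3 * t * M - L) / of_int (2 * L)] (ratmod int p)"
    "[S2 = of_int (- t * L - 9 * M) / of_int (18 * M)] (ratmod int p)"
    "[S3 = of_int (- t * L - M) / of_int (2 * M)] (ratmod int p)"
    "[S4 = of_int (27 * t * M - L) / of_int (2 * L)] (ratmod int p)"
proof -
  have t2: "(of_int t :: complex) * of_int t = 1" using t by auto
  have \<alpha>2: "\<alpha>\<^sup>2 = (- 1 - of_int t * \<theta>) / 2"
  proof -
    have "\<alpha>\<^sup>2 = (1 - 2 * of_int t * \<theta> + (of_int t * of_int t) * \<theta>\<^sup>2) / 4"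
      unfolding \<alpha> by (simp add: field_simps power2_eq_square)
    also have "\<dots> = (- 1 - of_int t * \<theta>) / 2" unfolding t2 theta_square by (simp add: field_simps)
    finally show ?thesis .
  qed
  have J: "J = (of_int L + 3 * of_int M * \<theta>) / 2" "cnj J = (of_int L - 3 * of_int M * \<theta>) / 2"
    unfolding J_LM[symmetric] by simp_all
  have "(cnj J * (2 * \<alpha> + \<alpha>\<^sup>2) + J * (\<alpha> + 2 * \<alpha>\<^sup>2)) / (3 * of_int L) = of_int (3 * t * M - L) / of_int (2 * L)"
    unfolding \<alpha>2 unfolding \<alpha> J(2) unfolding J(1) using LM_nonzero by (simp add: field_simps theta_mult)
  moreover have "(J * (\<alpha> + 2 * \<alpha>\<^sup>2) - cnj J * (2 * \<alpha> + \<alpha>\<^sup>2)) / (9 * of_int M * \<theta>) =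
      of_int (- t * L - 9 * M) / of_int (18 * M)"
    unfolding \<alpha>2 unfolding \<alpha> J(2) unfolding J(1)
    using LM_nonzero theta_nonzero by (simp add: field_simps theta_mult)
  moreover have "- (cnj J * (2 * \<alpha> - \<alpha>\<^sup>2) + J * (\<alpha> - 2 * \<alpha>\<^sup>2)) / (3 * of_int M * \<theta>) =
      of_int (- t * L - M) / of_int (2 * M)"
    unfolding \<alpha>2 unfolding \<alpha> J(2) unfolding J(1)
    using LM_nonzero theta_nonzero by (simp add: field_simps theta_mult)
  moreover have "(cnj J * (2 * \<alpha> - \<alpha>\<^sup>2) - J * (\<alpha> - 2 * \<alpha>\<^sup>2)) / of_int L = of_int (27 * t * M - L) / of_int (2 * L)"
    unfolding \<alpha>2 unfolding \<alpha> J(2) unfolding J(1) using LM_nonzero by (simp add: field_simps theta_mult)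
  ultimately have S:
    "of_rat S1 \<approx> of_int (3 * t * M - L) / of_int (2 * L)"
    "of_rat S2 \<approx> of_int (- t * L - 9 * M) / of_int (18 * M)"
    "of_rat S3 \<approx> of_int (- t * L - M) / of_int (2 * M)"
    "of_rat S4 \<approx> of_int (27 * t * M - L) / of_int (2 * L)"
    using sums_cg unfolding of_rat_S[symmetric] by simp_all
  have d: "\<not> int p dvd 2 * L" "\<not> int p dvd 2 * M" "\<not> int p dvd 2 * (3 * (3 * M))"
    by (simp_all only: not_dvd_mult not_p_dvd not_False_eq_True)
  show "[S1 = of_int (3 * t * M - L) / of_int (2 * L)] (ratmod int p)"
    using S(1) d(1) by (rule rat_cong_fractionI)
  show "[S2 = of_int (- t * L - 9 * M) / of_int (18 * M)] (ratmod int p)"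
    using S(2) d(3) by (intro rat_cong_fractionI) auto
  show "[S3 = of_int (- t * L - M) / of_int (2 * M)] (ratmod int p)"
    using S(3) d(2) by (rule rat_cong_fractionI)
  show "[S4 = of_int (27 * t * M - L) / of_int (2 * L)] (ratmod int p)"
    using S(4) d(1) by (rule rat_cong_fractionI)
qed

lemma alpha_eq:
  assumes "[int p ^ n = w ^ i] (mod int q)"
  shows "\<alpha> = \<omega> ^ (2 * i)"
  unfolding \<alpha>_def chi_eqI[OF not_q_dvd_p assms] by (simp add: power_mult[symmetric] mult.commute)

lemma not_q_dvd_2: "\<not> int q dvd 2"
  using q_gt_3 zdvd_imp_le[of "int q" 2] by auto

lemma not_q_dvd_M: "\<not> int q dvd M"
  by (rule norm_form_not_dvd[OF q q_gt_3 LM])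

lemma alpha_eq_1: "[int p ^ n = 1] (mod int q) \<Longrightarrow> \<alpha> = 1"
  using alpha_eq[of 0] by simp

text \<open>The divisibility says that p^n is w^2 for t = 1 and w for t = -1. As \<alpha> is the
  square of \<chi>(p), the two roots are swapped.\<close>

lemma alpha_eq_t:
  assumes t: "t = 1 \<or> t = - 1" and d: "int q dvd 2 * int p ^ n + 1 + t * (2 * w + 1)"
  shows "\<alpha> = (- 1 + of_int t * \<theta>) / 2"
  using t
proof
  assume t: "t = 1"
  have "2 * int p ^ n + 1 + t * (2 * w + 1) = 2 * (int p ^ n + 1 + w)" unfolding t by simp
  hence "int q dvd int p ^ n + 1 + w"
    using d not_q_dvd_2 prime_int_q by (metis prime_dvd_mult_iff)
  hence "int q dvd (int p ^ n + 1 + w) - (w\<^sup>2 + w + 1)" using w by (rule dvd_diff)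
  hence "[int p ^ n = w ^ 2] (mod int q)" by (simp add: cong_iff_dvd_diff)
  hence "\<alpha> = \<omega> ^ (2 * 2)" by (rule alpha_eq)
  also have "\<dots> = \<omega>" using omega_power_mod[of 4] by simp
  finally show ?thesis unfolding t \<theta>_def by simp
next
  assume t: "t = - 1"
  have "2 * int p ^ n + 1 + t * (2 * w + 1) = 2 * (int p ^ n - w)" unfolding t by simp
  hence "int q dvd int p ^ n - w"
    using d not_q_dvd_2 prime_int_q by (metis prime_dvd_mult_iff)
  hence "[int p ^ n = w ^ 1] (mod int q)" by (simp add: cong_iff_dvd_diff)
  hence "\<alpha> = \<omega> ^ (2 * 1)" by (rule alpha_eq)
  also have "\<omega> ^ (2 * 1) = \<omega>\<^sup>2" by simp
  also have "\<omega>\<^sup>2 = - 1 - \<omega>" using omega_poly by (simp add: algebra_simps eq_neg_iff_add_eq_0)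
  finally have \<alpha>: "\<alpha> = - 1 - \<omega>" .
  show ?thesis unfolding \<alpha> t \<theta>_def by (simp add: field_simps)
qed

text \<open>By \<open>wLM\<close>, L/(3M) is -(2w+1) modulo q.\<close>

lemma alpha_eq_L_over_M:
  fixes t :: int
  assumes t: "t = 1 \<or> t = - 1"
    and c: "[of_nat p ^ n = (- 1 + of_int t * (of_int L / (3 * of_int M))) / 2] (ratmod int q)"
  shows "\<alpha> = (- 1 + of_int t * \<theta>) / 2"
proof (rule alpha_eq_t[OF t])
  have "M \<noteq> 0" using pLM by auto
  hence "((- 1 + of_int t * (of_int L / (3 * of_int M))) / 2 :: rat) * of_int (6 * M) = of_int (t * L - 3 * M)"
    by (simp add: field_simps)
  moreover have "[of_int (int p ^ n) = (- 1 + of_int t * (of_int L / (3 * of_int M))) / 2] (ratmod int q)"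
    using c by simp
  ultimately have "int q dvd int p ^ n * (6 * M) - (t * L - 3 * M)"
    using rat_cong_fractionD[OF prime_int_q] by blast
  from dvd_add[OF this dvd_mult[OF wLM, of t]]
  have "int q dvd (int p ^ n * (6 * M) - (t * L - 3 * M)) + t * (L + 3 * M * (2 * w + 1))" .
  also have "\<dots> = 3 * (M * (2 * int p ^ n + 1 + t * (2 * w + 1)))"
    by (simp add: algebra_simps)
  finally show "int q dvd 2 * int p ^ n + 1 + t * (2 * w + 1)"
    using not_q_dvd_3 not_q_dvd_M prime_int_q by (metis prime_dvd_mult_iff)
qed

text \<open>By \<open>wLM\<close>, 9M/L is -3/(2w+1) modulo q, which equals 2w+1 because (2w+1)^2 is
  -3. Compared with L/(3M) the sign is opposite, hence -t.\<close>

lemma alpha_eq_M_over_L: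
  fixes t :: int
  assumes t: "t = 1 \<or> t = - 1"
    and c: "[of_nat p ^ n = (- 1 + of_int t * (9 * of_int M / of_int L)) / 2] (ratmod int q)"
  shows "\<alpha> = (- 1 + of_int (- t) * \<theta>) / 2"
proof (rule alpha_eq_t)
  show "- t = 1 \<or> - t = - 1" using t by auto
  have "L \<noteq> 0" using pLM by auto
  hence "((- 1 + of_int t * (9 * of_int M / of_int L)) / 2 :: rat) * of_int (2 * L) = of_int (9 * t * M - L)"
    by (simp add: field_simps)
  moreover have "[of_int (int p ^ n) = (- 1 + of_int t * (9 * of_int M / of_int L)) / 2] (ratmod int q)"
    using c by simp
  ultimately have "int q dvd int p ^ n * (2 * L) - (9 * t * M - L)"
    using rat_cong_fractionD[OF prime_int_q] by blast
  \<comment> \<open>The multiple of w^2 + w + 1 replaces 9tM by -3tM(2w+1)^2, so that 2w+1 becomes a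
    common factor; it is prime to q and cancels.\<close>
  from dvd_diff[OF dvd_diff[OF dvd_mult2[OF wLM] this] dvd_mult[OF w]]
  have "int q dvd (L + 3 * M * (2 * w + 1)) * (2 * int p ^ n + 1) - (int p ^ n * (2 * L) - (9 * t * M - L))
      - 12 * t * M * (w\<^sup>2 + w + 1)" .
  also have "\<dots> = 3 * (M * ((2 * w + 1) * (2 * int p ^ n + 1 + (- t) * (2 * w + 1))))"
    by (simp add: algebra_simps power2_eq_square)
  finally have "int q dvd (2 * w + 1) * (2 * int p ^ n + 1 + (- t) * (2 * w + 1))"
    using not_q_dvd_3 not_q_dvd_M prime_int_q by (metis prime_dvd_mult_iff)
  moreover have "\<not> int q dvd 2 * w + 1"
  proof
    assume "int q dvd 2 * w + 1"
    from dvd_diff[OF dvd_mult[OF w] dvd_mult[OF this]]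
    have "int q dvd 4 * (w\<^sup>2 + w + 1) - (2 * w + 1) * (2 * w + 1)" .
    also have "\<dots> = 3" by (simp add: algebra_simps power2_eq_square)
    finally show False using not_q_dvd_3 by blast
  qed
  ultimately show "int q dvd 2 * int p ^ n + 1 + (- t) * (2 * w + 1)"
    using prime_int_q prime_dvd_mult_iff by blast
qed

end

text \<open>The second condition is linear in \<open>w\<close> and solvable since q does not divide
  6M. It gives 9M^2 (2w+1)^2 = L^2 = -27M^2 modulo q, so (2w+1)^2 is -3, which is the first
  condition.\<close>

lemma cube_root_of_unity_mod_exists:
  fixes L M :: int
  assumes q: "prime q" "[q = 1] (mod 3)" and LM: "4 * int q = L\<^sup>2 + 27 * M\<^sup>2"
  obtains w where "int q dvd w\<^sup>2 + w + 1" "int q dvd L + 3 * M * (2 * w + 1)"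
proof -
  have q': "prime (int q)" using q(1) by simp
  have "q \<noteq> 2" "q \<noteq> 3" using q(2) by (auto simp: cong_def)
  hence q3: "q > 3" using prime_ge_2_nat[OF q(1)] by simp
  have n2: "\<not> int q dvd 2" using q3 zdvd_imp_le[of "int q" 2] by auto
  have n3: "\<not> int q dvd 3" using q3 zdvd_imp_le[of "int q" 3] by auto
  have nM: "\<not> int q dvd M" by (rule norm_form_not_dvd[OF q(1) q3 LM])
  have n6: "\<not> int q dvd 2 * (3 * M)" using q' n2 n3 nM by (simp only: prime_dvd_mult_iff simp_thms)
  hence "coprime (2 * (3 * M)) (int q)" using q' prime_imp_coprime coprime_commute by blast
  then obtain y where y: "[2 * (3 * M) * y = 1] (mod int q)" using cong_solve_coprime_int by blast
  define w where "w = y * (- L - 3 * M)"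
  have "int q dvd (2 * (3 * M) * y - 1) * (- L - 3 * M)" using y by (simp add: cong_iff_dvd_diff)
  also have "\<dots> = L + 3 * M * (2 * w + 1)" unfolding w_def by (simp add: algebra_simps)
  finally have 1: "int q dvd L + 3 * M * (2 * w + 1)" .
  have "2 * (3 * M) * (2 * (3 * M)) * (w\<^sup>2 + w + 1) =
      (L + 3 * M * (2 * w + 1)) * (3 * M * (2 * w + 1) - L) + (L\<^sup>2 + 27 * M\<^sup>2)"
    by (simp add: algebra_simps power2_eq_square)
  also have "int q dvd \<dots>" unfolding LM[symmetric] by (rule dvd_add[OF dvd_mult2[OF 1]]) simp
  finally have 2: "int q dvd w\<^sup>2 + w + 1" using n6 q' prime_dvd_mult_iff by blast
  from 2 1 show ?thesis by (rule that)
qed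

theorem theorem27:
  fixes p q :: nat and L M :: int
  assumes "prime q" and "[q = 1] (mod 3)"
    and "4 * int q = L\<^sup>2 + 27 * M\<^sup>2" and "[L = 1] (mod 3)"
    and "prime p" and "p \<noteq> 2" and "p \<noteq> 3" and "p \<noteq> q"
    and "\<not> int p dvd L * M"
  defines "l \<equiv> (of_int L :: rat)" and "m \<equiv> (of_int M :: rat)"
    and "S1 \<equiv> \<Sum>k = 0..p - 1. of_nat ((3 * k) choose k) * (of_int M ^ (2 * k) / of_nat q ^ k) :: rat"
    and "S2 \<equiv> \<Sum>k = 0..p - 1. of_nat ((3 * k) choose k) * (of_int L ^ (2 * k) / (27 * of_nat q) ^ k) :: rat"
    and "S3 \<equiv> \<Sum>k = 0..p - 1. catalan2 k * (of_int M ^ (2 * k) / of_nat q ^ k) :: rat"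
    and "S4 \<equiv> \<Sum>k = 0..p - 1. catalan2 k * (of_int L ^ (2 * k) / (27 * of_nat q) ^ k) :: rat"
    and "P \<equiv> (of_nat p ^ ((q - 1) div 3) :: rat)"
  shows
    "(([P = 1] (ratmod int q) \<longrightarrow> [S1 = 1] (ratmod int p)) \<and>
      (\<forall>s \<in> {1, -1}. [P = (-1 + s * (l / (3 * m))) / 2] (ratmod int q) \<longrightarrow>
         [S1 = (s * (3 * m) - l) / (2 * l)] (ratmod int p))) \<and>
     (([P = 1] (ratmod int q) \<longrightarrow> [S2 = 1] (ratmod int p)) \<and>
      (\<forall>s \<in> {1, -1}. [P = (-1 + s * (9 * m / l)) / 2] (ratmod int q) \<longrightarrow>
         [S2 = (s * l - 9 * m) / (18 * m)] (ratmod int p))) \<and>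
     (([P = 1] (ratmod int q) \<longrightarrow> [S3 = 1] (ratmod int p)) \<and>
      (\<forall>s \<in> {1, -1}. [P = (-1 + s * (9 * m / l)) / 2] (ratmod int q) \<longrightarrow>
         [S3 = (s * l - m) / (2 * m)] (ratmod int p))) \<and>
     (([P = 1] (ratmod int q) \<longrightarrow> [S4 = 1] (ratmod int p)) \<and>
      (\<forall>s \<in> {1, -1}. [P = (-1 + s * (l / (3 * m))) / 2] (ratmod int q) \<longrightarrow>
         [S4 = (s * (27 * m) - l) / (2 * l)] (ratmod int p)))"
proof -
  obtain w where w: "int q dvd w\<^sup>2 + w + 1" "int q dvd L + 3 * M * (2 * w + 1)"
    using cube_root_of_unity_mod_exists[OF assms(1-3)] .
  \<comment> \<open>As \<open>w\<close> depends only on q, L and M, this one instance serves all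
    four sums and both signs.\<close>
  interpret F: cubic_norm_form q w p "3 * q" L M
    by unfold_locales
      (use assms w prime_gt_0_nat[OF assms(1)] in \<open>auto simp: cong_def\<close>)
  have S: "F.S1 = S1" "F.S2 = S2" "F.S3 = S3" "F.S4 = S4"
    unfolding F.S1_def F.S2_def F.S3_def F.S4_def S1_def S2_def S3_def S4_def by simp_all
  have P: "P = of_nat p ^ F.n" unfolding P_def F.n_def ..
  have "F.\<alpha> = 1" if "[P = 1] (ratmod int q)"
  proof -
    have "[of_int (int p ^ F.n) = 1] (ratmod int q)" using that P by simp
    from rat_cong_fractionD[OF F.prime_int_q this, of 1 1] have "[int p ^ F.n = 1] (mod int q)"
      by (simp add: cong_iff_dvd_diff)
    thus ?thesis by (rule F.alpha_eq_1)
  qed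
  hence one: "[S1 = 1] (ratmod int p) \<and> [S2 = 1] (ratmod int p) \<and>
      [S3 = 1] (ratmod int p) \<and> [S4 = 1] (ratmod int p)" if "[P = 1] (ratmod int q)"
    using F.S_cong_1 that unfolding S by blast
  have sign: "\<exists>t :: int. (t = 1 \<or> t = - 1) \<and> s = of_int t" if "s \<in> {1, - 1}" for s :: rat
    using that by (auto intro: exI[of _ 1] exI[of _ "- 1"])
  have res_L_M: "[S1 = (s * (3 * m) - l) / (2 * l)] (ratmod int p) \<and>
      [S4 = (s * (27 * m) - l) / (2 * l)] (ratmod int p)"
    if "s \<in> {1, - 1}" "[P = (-1 + s * (l / (3 * m))) / 2] (ratmod int q)" for s
  proof -
    obtain t :: int where t: "t = 1 \<or> t = - 1" "s = of_int t" using sign[OF \<open>s \<in> {1, - 1}\<close>] by blast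
    have "F.\<alpha> = (- 1 + of_int t * F.\<theta>) / 2"
      using t(1) that(2) unfolding P l_def m_def t(2) by (rule F.alpha_eq_L_over_M)
    from F.S_cong_t(1,4)[OF this t(1)] show ?thesis
      unfolding S l_def m_def t(2) by (simp add: algebra_simps)
  qed
  have res_M_L: "[S2 = (s * l - 9 * m) / (18 * m)] (ratmod int p) \<and>
      [S3 = (s * l - m) / (2 * m)] (ratmod int p)"
    if "s \<in> {1, - 1}" "[P = (-1 + s * (9 * m / l)) / 2] (ratmod int q)" for s
  proof -
    obtain t :: int where t: "t = 1 \<or> t = - 1" "s = of_int t" using sign[OF \<open>s \<in> {1, - 1}\<close>] by blast
    have "F.\<alpha> = (- 1 + of_int (- t) * F.\<theta>) / 2"
      using t(1) that(2) unfolding P l_def m_def t(2) by (rule F.alpha_eq_M_over_L)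
    moreover have "- t = 1 \<or> - t = - 1" using t(1) by auto
    ultimately show ?thesis
      using F.S_cong_t(2,3)[of "- t"] unfolding S l_def m_def t(2) by (simp add: algebra_simps)
  qed
  show ?thesis using one res_L_M res_M_L by blast
qed

end
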